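(* Let $G$ be an undirected graph. Suppose that for the vertex-cover-weighted Steiner tree problem on $G$ there exists an optimal solution $(F,U)$ such that each vertex in $U$ has degree at most $\alpha$ in the tree $F$. If there is a $\beta$-approximation algorithm for the connected dominating set problem on the graph $G$, then there is an $(\alpha+1)\beta$-approximation algorithm for the vertex-cover-weighted Steiner tree problem with input graph $G$.
   Context: Vertex-cover-weighted Steiner tree problem: given an undirected graph $G=(V,E)$, weights $w\in\mathbb{R}_+^V$ and terminals $T\subseteq V$, find a tree $F$ in $G$ with $T\subseteq V(F)$ and a vertex cover $U\subseteq V(F)$ of $F$, minimizing $w(U)$. Connected dominating set problem: given an undirected graph $G=(V,E)$, terminals $T\subseteq V$, edge lengths $l(e)\in\mathbb{R}_+$ and vertex weights $w(v)\in\mathbb{R}_+$ with $l(e)\le\min\{w(u),w(v)\}$ for every edge $e=uv$, find a tree $F\subseteq E$ and a vertex set $S\subseteq V$ such that $S$ dominates $T$ (every $t\in T$ is in $S$ or adjacent to a vertex of $S$) and $F$ spans $S$, minimizing $w(S)+\sum_{e\in F}l(e)$. A $\rho$-approximation algorithm is a polynomial-time algorithm that always outputs a feasible solution of objective value at most $\rho$ times the optimum. *)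

theory Defs
  imports Complex_Main "HOL-Library.Log_Nat" "HOL-Computational_Algebra.Polynomial"
begin

section \<open>Finite simple undirected graphs and trees\<close>

record graph =
  verts :: "nat set"
  edges :: "nat set set"

definition ugraph :: "graph \<Rightarrow> bool" where
  "ugraph G \<longleftrightarrow> finite (verts G) \<and> (\<forall>e \<in> edges G. e \<subseteq> verts G \<and> card e = 2)"

definition subgraph :: "graph \<Rightarrow> graph \<Rightarrow> bool" where
  "subgraph H G \<longleftrightarrow> verts H \<subseteq> verts G \<and> edges H \<subseteq> edges G"

definition walk :: "graph \<Rightarrow> nat list \<Rightarrow> bool" where
  "walk G p \<longleftrightarrow> p \<noteq> [] \<and> set p \<subseteq> verts G \<and> successively (\<lambda>u v. {u, v} \<in> edges G) p"

definition cycle :: "graph \<Rightarrow> nat list \<Rightarrow> bool" where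
  "cycle G p \<longleftrightarrow> walk G p \<and> distinct p \<and> 3 \<le> length p \<and> {last p, hd p} \<in> edges G"

definition connected_graph :: "graph \<Rightarrow> bool" where
  "connected_graph G \<longleftrightarrow> verts G \<noteq> {} \<and>
     (\<forall>u \<in> verts G. \<forall>v \<in> verts G. \<exists>p. walk G p \<and> hd p = u \<and> last p = v)"

definition tree :: "graph \<Rightarrow> bool" where
  "tree G \<longleftrightarrow> ugraph G \<and> connected_graph G \<and> (\<nexists>p. cycle G p)"

definition degree_in :: "graph \<Rightarrow> nat \<Rightarrow> nat" where
  "degree_in G v = card {e \<in> edges G. v \<in> e}"

definition vertex_cover :: "graph \<Rightarrow> nat set \<Rightarrow> bool" where
  "vertex_cover G U \<longleftrightarrow> U \<subseteq> verts G \<and> (\<forall>e \<in> edges G. e \<inter> U \<noteq> {})"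

definition dominates :: "graph \<Rightarrow> nat set \<Rightarrow> nat set \<Rightarrow> bool" where
  "dominates G S T \<longleftrightarrow> (\<forall>t \<in> T. t \<in> S \<or> (\<exists>s \<in> S. {s, t} \<in> edges G))"

text \<open>
  A tree given by its edge set \<open>F\<close> spans \<open>S\<close> if its vertex set contains \<open>S\<close>; it may have further
  vertices. The vertex set is existentially quantified only because of the single-vertex trees,
  whose edge set is empty; a tree with an edge has vertex set \<open>\<Union>F\<close>.
\<close>

definition spans_tree :: "graph \<Rightarrow> nat set set \<Rightarrow> nat set \<Rightarrow> bool" where
  "spans_tree G F S \<longleftrightarrow>
     (\<exists>W. tree \<lparr>verts = W, edges = F\<rparr> \<and> subgraph \<lparr>verts = W, edges = F\<rparr> G \<and> S \<subseteq> W)"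


section \<open>Programs and their running time\<close>

text \<open>
  Data are binary trees whose leaves are \<open>VNil\<close> or numbers; programs are structured while-programs
  over finitely many variables holding such data. Evaluating an expression costs the total size of
  all its intermediate results. There are two ways of charging for a number:

  \<^item> \<open>Bit_Cost\<close>: inputs are rational, and a number costs the bit length of its
    numerator and denominator. As every operation is charged for the size of its result, time in this
    model agrees with Turing machine time up to a polynomial.

  \<^item> \<open>Unit_Cost\<close>: inputs are arbitrary real numbers, and every number costs 1.
    This is the real RAM.
\<close>

datatype cost_model = Bit_Cost | Unit_Cost

fun numbers :: "cost_model \<Rightarrow> real set" where
  "numbers Bit_Cost = \<rat>"
| "numbers Unit_Cost = UNIV"

text \<open>Under \<open>Bit_Cost\<close> no irrational number is ever computed from a rational input, so the value
  of \<open>inv real_of_rat\<close> outside the rationals is irrelevant.\<close>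

fun num_size :: "cost_model \<Rightarrow> real \<Rightarrow> nat" where
  "num_size Bit_Cost r =
     (let (p, q) = quotient_of (inv real_of_rat r)
      in 1 + floorlog 2 (nat \<bar>p\<bar>) + floorlog 2 (nat q))"
| "num_size Unit_Cost r = 1"

datatype val = VNil | VNum real | VPair val val

fun val_size :: "cost_model \<Rightarrow> val \<Rightarrow> nat" where
  "val_size M VNil = 1"
| "val_size M (VNum r) = num_size M r"
| "val_size M (VPair a b) = 1 + val_size M a + val_size M b"

datatype arith = Add | Sub | Mul | Div

fun arith_fun :: "arith \<Rightarrow> real \<Rightarrow> real \<Rightarrow> real" where
  "arith_fun Add x y = x + y"
| "arith_fun Sub x y = x - y"
| "arith_fun Mul x y = x * y"
| "arith_fun Div x y = x / y"

datatype exp =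
    Var nat
  | Const rat
  | Empty
  | Cons exp exp
  | Fst exp
  | Snd exp
  | Arith arith exp exp

datatype test = Less exp exp | Is_Num exp | Is_Pair exp

datatype com =
    Skip
  | Assign nat exp
  | Seq com com
  | If test com com
  | While test com

type_synonym state = "nat \<Rightarrow> val"

text \<open>All operations are total: projections of non-pairs yield \<open>VNil\<close>, and non-numbers count as 0
  in arithmetic and comparisons.\<close>

fun the_num :: "val \<Rightarrow> real" where
  "the_num (VNum r) = r"
| "the_num _ = 0"

fun the_fst :: "val \<Rightarrow> val" where
  "the_fst (VPair a b) = a"
| "the_fst _ = VNil"

fun the_snd :: "val \<Rightarrow> val" where
  "the_snd (VPair a b) = b"
| "the_snd _ = VNil"

fun eval_exp :: "exp \<Rightarrow> state \<Rightarrow> val" where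
  "eval_exp (Var x) s = s x"
| "eval_exp (Const c) s = VNum (real_of_rat c)"
| "eval_exp Empty s = VNil"
| "eval_exp (Cons a b) s = VPair (eval_exp a s) (eval_exp b s)"
| "eval_exp (Fst a) s = the_fst (eval_exp a s)"
| "eval_exp (Snd a) s = the_snd (eval_exp a s)"
| "eval_exp (Arith f a b) s = VNum (arith_fun f (the_num (eval_exp a s)) (the_num (eval_exp b s)))"

fun exp_cost :: "cost_model \<Rightarrow> exp \<Rightarrow> state \<Rightarrow> nat" where
  "exp_cost M (Var x) s = val_size M (eval_exp (Var x) s)"
| "exp_cost M (Const c) s = val_size M (eval_exp (Const c) s)"
| "exp_cost M Empty s = val_size M (eval_exp Empty s)"
| "exp_cost M (Cons a b) s = exp_cost M a s + exp_cost M b s + val_size M (eval_exp (Cons a b) s)"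
| "exp_cost M (Fst a) s = exp_cost M a s + val_size M (eval_exp (Fst a) s)"
| "exp_cost M (Snd a) s = exp_cost M a s + val_size M (eval_exp (Snd a) s)"
| "exp_cost M (Arith f a b) s =
     exp_cost M a s + exp_cost M b s + val_size M (eval_exp (Arith f a b) s)"

fun eval_test :: "test \<Rightarrow> state \<Rightarrow> bool" where
  "eval_test (Less a b) s \<longleftrightarrow> the_num (eval_exp a s) < the_num (eval_exp b s)"
| "eval_test (Is_Num a) s \<longleftrightarrow> (\<exists>r. eval_exp a s = VNum r)"
| "eval_test (Is_Pair a) s \<longleftrightarrow> (\<exists>u v. eval_exp a s = VPair u v)"

fun test_cost :: "cost_model \<Rightarrow> test \<Rightarrow> state \<Rightarrow> nat" where
  "test_cost M (Less a b) s = 1 + exp_cost M a s + exp_cost M b s"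
| "test_cost M (Is_Num a) s = 1 + exp_cost M a s"
| "test_cost M (Is_Pair a) s = 1 + exp_cost M a s"

text \<open>\<open>exec M c s t s'\<close>: program \<open>c\<close> started in \<open>s\<close> halts in \<open>s'\<close> after time \<open>t\<close>.\<close>

inductive exec :: "cost_model \<Rightarrow> com \<Rightarrow> state \<Rightarrow> nat \<Rightarrow> state \<Rightarrow> bool" for M where
  Skip: "exec M Skip s 1 s"
| Assign: "exec M (Assign x a) s (1 + exp_cost M a s) (s(x := eval_exp a s))"
| Seq: "exec M c s t s' \<Longrightarrow> exec M d s' t' s'' \<Longrightarrow> exec M (Seq c d) s (t + t') s''"
| If_True: "eval_test b s \<Longrightarrow> exec M c s t s' \<Longrightarrow> exec M (If b c d) s (test_cost M b s + t) s'"
| If_False: "\<not> eval_test b s \<Longrightarrow> exec M d s t s' \<Longrightarrow> exec M (If b c d) s (test_cost M b s + t) s'"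
| While_False: "\<not> eval_test b s \<Longrightarrow> exec M (While b c) s (test_cost M b s) s"
| While_True: "eval_test b s \<Longrightarrow> exec M c s t s' \<Longrightarrow> exec M (While b c) s' t' s'' \<Longrightarrow>
    exec M (While b c) s (test_cost M b s + t + t') s''"

definition computes :: "cost_model \<Rightarrow> com \<Rightarrow> val \<Rightarrow> nat \<Rightarrow> val \<Rightarrow> bool" where
  "computes M c x t y \<longleftrightarrow> (\<exists>s. exec M c ((\<lambda>_. VNil)(0 := x)) t s \<and> s 0 = y)"


section \<open>Minimization problems and approximation algorithms\<close>

record ('i, 's) problem =
  feasible :: "'i \<Rightarrow> 's \<Rightarrow> bool"
  objective :: "'i \<Rightarrow> 's \<Rightarrow> real"
  encodes_instance :: "val \<Rightarrow> 'i \<Rightarrow> bool"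
  encodes_solution :: "val \<Rightarrow> 's \<Rightarrow> bool"

definition optimal :: "('i, 's) problem \<Rightarrow> 'i \<Rightarrow> 's \<Rightarrow> bool" where
  "optimal P i s \<longleftrightarrow> feasible P i s \<and> (\<forall>s'. feasible P i s' \<longrightarrow> objective P i s \<le> objective P i s')"

text \<open>
  The algorithm \<open>A\<close> has to handle those instances in \<open>I\<close> that have a feasible solution at all.
  The ratio \<open>\<rho>\<close> may depend on the instance.
\<close>

definition approx_algorithm ::
  "cost_model \<Rightarrow> ('i, 's) problem \<Rightarrow> 'i set \<Rightarrow> ('i \<Rightarrow> real) \<Rightarrow> com \<Rightarrow> bool" where
  "approx_algorithm M P I \<rho> A \<longleftrightarrow>
     (\<exists>p :: nat poly. \<forall>i \<in> I. \<forall>x. (\<exists>s. feasible P i s) \<and> encodes_instance P x i \<longrightarrow>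
       (\<exists>t y s. computes M A x t y \<and> t \<le> poly p (val_size M x) \<and>
          encodes_solution P y s \<and> feasible P i s \<and>
          (\<forall>s'. optimal P i s' \<longrightarrow> objective P i s \<le> \<rho> i * objective P i s')))"


section \<open>Encoding of graphs and vertex sets\<close>

fun enc_list :: "val list \<Rightarrow> val" where
  "enc_list [] = VNil"
| "enc_list (x # xs) = VPair x (enc_list xs)"

definition enc_vertex :: "nat \<Rightarrow> val" where
  "enc_vertex v = VNum (real v)"

fun enc_edge :: "nat \<times> nat \<Rightarrow> val" where
  "enc_edge (u, v) = VPair (enc_vertex u) (enc_vertex v)"

fun ends :: "nat \<times> nat \<Rightarrow> nat set" where
  "ends (u, v) = {u, v}"

text \<open>Finite sets are given by listing their elements in any order, without repetition in inputs;
  edges are given by their ends in either order.\<close>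

definition encodes_verts :: "val \<Rightarrow> nat set \<Rightarrow> bool" where
  "encodes_verts x U \<longleftrightarrow> (\<exists>us. set us = U \<and> x = enc_list (map enc_vertex us))"

definition encodes_edges :: "val \<Rightarrow> nat set set \<Rightarrow> bool" where
  "encodes_edges x F \<longleftrightarrow> (\<exists>es. ends ` set es = F \<and> x = enc_list (map enc_edge es))"


section \<open>Vertex-cover-weighted Steiner tree\<close>

text \<open>An instance is \<open>(G, w, T)\<close>; a solution is \<open>(F, U)\<close>.\<close>

type_synonym vcst_instance = "graph \<times> (nat \<Rightarrow> real) \<times> nat set"
type_synonym vcst_solution = "graph \<times> nat set"

definition vcst_instances :: "cost_model \<Rightarrow> graph set \<Rightarrow> vcst_instance set" where
  "vcst_instances M \<G> = {(G, w, T). G \<in> \<G> \<and> T \<subseteq> verts G \<and>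
     (\<forall>v \<in> verts G. 0 \<le> w v \<and> w v \<in> numbers M)}"

fun vcst_feasible :: "vcst_instance \<Rightarrow> vcst_solution \<Rightarrow> bool" where
  "vcst_feasible (G, w, T) (F, U) \<longleftrightarrow>
     tree F \<and> subgraph F G \<and> T \<subseteq> verts F \<and> vertex_cover F U"

fun vcst_objective :: "vcst_instance \<Rightarrow> vcst_solution \<Rightarrow> real" where
  "vcst_objective (G, w, T) (F, U) = sum w U"

fun vcst_encodes_instance :: "val \<Rightarrow> vcst_instance \<Rightarrow> bool" where
  "vcst_encodes_instance x (G, w, T) \<longleftrightarrow>
     (\<exists>vs es ts. set vs = verts G \<and> distinct vs \<and>
        ends ` set es = edges G \<and> distinct (map ends es) \<and>
        set ts = T \<and> distinct ts \<and>
        x = enc_list [enc_list (map (\<lambda>v. VPair (enc_vertex v) (VNum (w v))) vs),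
                      enc_list (map enc_edge es),
                      enc_list (map enc_vertex ts)])"

fun vcst_encodes_solution :: "val \<Rightarrow> vcst_solution \<Rightarrow> bool" where
  "vcst_encodes_solution y (F, U) \<longleftrightarrow>
     (\<exists>a b c. y = enc_list [a, b, c] \<and>
        encodes_verts a (verts F) \<and> encodes_edges b (edges F) \<and> encodes_verts c U)"

definition vcst :: "(vcst_instance, vcst_solution) problem" where
  "vcst = \<lparr>feasible = vcst_feasible, objective = vcst_objective,
           encodes_instance = vcst_encodes_instance, encodes_solution = vcst_encodes_solution\<rparr>"


section \<open>Connected dominating set\<close>

text \<open>An instance is \<open>(G, w, l, T)\<close>; a solution is \<open>(F, S)\<close> with \<open>F\<close> an edge set.\<close>

type_synonym cds_instance = "graph \<times> (nat \<Rightarrow> real) \<times> (nat set \<Rightarrow> real) \<times> nat set"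
type_synonym cds_solution = "nat set set \<times> nat set"

definition cds_instances :: "cost_model \<Rightarrow> graph set \<Rightarrow> cds_instance set" where
  "cds_instances M \<G> = {(G, w, l, T). G \<in> \<G> \<and> T \<subseteq> verts G \<and>
     (\<forall>v \<in> verts G. 0 \<le> w v \<and> w v \<in> numbers M) \<and>
     (\<forall>e \<in> edges G. 0 \<le> l e \<and> l e \<in> numbers M \<and> (\<forall>v \<in> e. l e \<le> w v))}"

fun cds_feasible :: "cds_instance \<Rightarrow> cds_solution \<Rightarrow> bool" where
  "cds_feasible (G, w, l, T) (F, S) \<longleftrightarrow>
     F \<subseteq> edges G \<and> S \<subseteq> verts G \<and> dominates G S T \<and> spans_tree G F S"

fun cds_objective :: "cds_instance \<Rightarrow> cds_solution \<Rightarrow> real" where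
  "cds_objective (G, w, l, T) (F, S) = sum w S + sum l F"

fun cds_encodes_instance :: "val \<Rightarrow> cds_instance \<Rightarrow> bool" where
  "cds_encodes_instance x (G, w, l, T) \<longleftrightarrow>
     (\<exists>vs es ts. set vs = verts G \<and> distinct vs \<and>
        ends ` set es = edges G \<and> distinct (map ends es) \<and>
        set ts = T \<and> distinct ts \<and>
        x = enc_list [enc_list (map (\<lambda>v. VPair (enc_vertex v) (VNum (w v))) vs),
                      enc_list (map (\<lambda>e. VPair (enc_edge e) (VNum (l (ends e)))) es),
                      enc_list (map enc_vertex ts)])"

fun cds_encodes_solution :: "val \<Rightarrow> cds_solution \<Rightarrow> bool" where
  "cds_encodes_solution y (F, S) \<longleftrightarrow>
     (\<exists>a b. y = enc_list [a, b] \<and> encodes_edges a F \<and> encodes_verts b S)"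

definition cds :: "(cds_instance, cds_solution) problem" where
  "cds = \<lparr>feasible = cds_feasible, objective = cds_objective,
          encodes_instance = cds_encodes_instance, encodes_solution = cds_encodes_solution\<rparr>"

end

theory Submission
  imports Defs
begin

text \<open>
  Give every edge the smaller of the weights of its ends as length. Charging each edge of a tree to an
  end in a vertex cover \<open>U\<close> of maximum degree \<open>\<alpha>\<close> bounds the total length by \<open>\<alpha> w(U)\<close>; and if there
  are two terminals, \<open>U\<close> dominates the tree. So the optimum of connected dominating set is
  at most \<open>\<alpha> + 1\<close> times that of the Steiner tree problem. Conversely, from a solution \<open>(F, S)\<close> one
  gets a Steiner tree by joining every terminal missed by \<open>F\<close> to a neighbour in \<open>S\<close>, and \<open>S\<close> together
  with the cheaper end of each edge of \<open>F\<close> is a vertex cover of no larger cost. With at most one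
  terminal a single vertex with empty cover is optimal; this case is separate because the
  optimum \<open>0\<close> need not carry over to the dominating set instance.

  For the running time, the polynomial-time functions on values are closed under
  composition, pairing, case distinction and flat-mapping over lists, and the translations between
  the two problems are built from these operations.
\<close>

section \<open>Programs\<close>

fun exp_vars :: "exp \<Rightarrow> nat set" where
  "exp_vars (Var x) = {x}"
| "exp_vars (Const c) = {}"
| "exp_vars Empty = {}"
| "exp_vars (Cons a b) = exp_vars a \<union> exp_vars b"
| "exp_vars (Fst a) = exp_vars a"
| "exp_vars (Snd a) = exp_vars a"
| "exp_vars (Arith f a b) = exp_vars a \<union> exp_vars b"

fun test_vars :: "test \<Rightarrow> nat set" where
  "test_vars (Less a b) = exp_vars a \<union> exp_vars b"
| "test_vars (Is_Num a) = exp_vars a"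
| "test_vars (Is_Pair a) = exp_vars a"

fun com_vars :: "com \<Rightarrow> nat set" where
  "com_vars Skip = {}"
| "com_vars (Assign x a) = insert x (exp_vars a)"
| "com_vars (Seq c d) = com_vars c \<union> com_vars d"
| "com_vars (If b c d) = test_vars b \<union> com_vars c \<union> com_vars d"
| "com_vars (While b c) = test_vars b \<union> com_vars c"

lemma finite_exp_vars: "finite (exp_vars a)"
  by (induction a) auto

lemma finite_test_vars: "finite (test_vars b)"
  by (cases b) (auto simp: finite_exp_vars)

lemma finite_com_vars: "finite (com_vars c)"
  by (induction c) (auto simp: finite_exp_vars finite_test_vars)

lemma eval_exp_cong: "\<forall>x \<in> exp_vars a. s x = z x \<Longrightarrow> eval_exp a s = eval_exp a z"
  by (induction a) auto

lemma exp_cost_cong: "\<forall>x \<in> exp_vars a. s x = z x \<Longrightarrow> exp_cost M a s = exp_cost M a z"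
proof (induction a)
  case (Cons a b)
  then show ?case using eval_exp_cong[of "Cons a b" s z] by auto
next
  case (Fst a)
  then show ?case using eval_exp_cong[of "Fst a" s z] by auto
next
  case (Snd a)
  then show ?case using eval_exp_cong[of "Snd a" s z] by auto
next
  case (Arith f a b)
  then show ?case using eval_exp_cong[of "Arith f a b" s z] by auto
qed auto

lemma eval_test_cong: "\<forall>x \<in> test_vars b. s x = z x \<Longrightarrow> eval_test b s = eval_test b z"
  by (cases b) (auto simp: eval_exp_cong[of _ s z])

lemma test_cost_cong: "\<forall>x \<in> test_vars b. s x = z x \<Longrightarrow> test_cost M b s = test_cost M b z"
  by (cases b) (auto simp: exp_cost_cong[of _ s z])

text \<open>A given algorithm is specified only for start states that are \<open>VNil\<close>
  outside variable 0. This transfers such a run, with the same time, to a state that keeps saved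
  data outside \<open>X\<close>. The set \<open>X\<close> stays fixed when the induction passes to
  subcommands, so it is any superset of the variables rather than \<open>com_vars c\<close>
  itself.\<close>

lemma exec_frame:
  assumes "exec M c s t s'" "com_vars c \<subseteq> X" "\<forall>x \<in> X. s x = z x"
  shows "\<exists>z'. exec M c z t z' \<and> (\<forall>x \<in> X. z' x = s' x) \<and> (\<forall>x. x \<notin> X \<longrightarrow> z' x = z x)"
  using assms
proof (induction arbitrary: z rule: exec.induct)
  case (Skip s)
  then show ?case using exec.Skip by metis
next
  case (Assign x a s)
  have *: "\<forall>x \<in> exp_vars a. s x = z x" using Assign by auto
  have "exec M (Assign x a) z (1 + exp_cost M a s) (z(x := eval_exp a s))"
    using exec.Assign[of M x a z] exp_cost_cong[OF *, of M] eval_exp_cong[OF *] by simp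
  moreover have "\<forall>y \<in> X. (z(x := eval_exp a s)) y = (s(x := eval_exp a s)) y"
    "\<forall>y. y \<notin> X \<longrightarrow> (z(x := eval_exp a s)) y = z y"
    using Assign.prems by auto
  ultimately show ?case by blast
next
  case (Seq c s t s' d t' s'')
  from Seq.IH(1)[of z] Seq.prems obtain z1 where
    1: "exec M c z t z1" "\<forall>x \<in> X. z1 x = s' x" "\<forall>x. x \<notin> X \<longrightarrow> z1 x = z x" by auto
  from Seq.IH(2)[of z1] Seq.prems 1(2) obtain z2 where
    "exec M d z1 t' z2" "\<forall>x \<in> X. z2 x = s'' x" "\<forall>x. x \<notin> X \<longrightarrow> z2 x = z1 x" by auto
  with 1 show ?case using exec.Seq[OF 1(1)] by metis
next
  case (If_True b s c t s' d)
  have *: "\<forall>x \<in> test_vars b. s x = z x" using If_True.prems by auto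
  from If_True.IH[of z] If_True.prems obtain z1 where
    1: "exec M c z t z1" "\<forall>x \<in> X. z1 x = s' x" "\<forall>x. x \<notin> X \<longrightarrow> z1 x = z x" by auto
  then show ?case
    using exec.If_True[of b z M c t z1 d] If_True.hyps(1) eval_test_cong[OF *]
      test_cost_cong[OF *, of M] by auto
next
  case (If_False b s d t s' c)
  have *: "\<forall>x \<in> test_vars b. s x = z x" using If_False.prems by auto
  from If_False.IH[of z] If_False.prems obtain z1 where
    1: "exec M d z t z1" "\<forall>x \<in> X. z1 x = s' x" "\<forall>x. x \<notin> X \<longrightarrow> z1 x = z x" by auto
  then show ?case
    using exec.If_False[of b z M d t z1 c] If_False.hyps(1) eval_test_cong[OF *]
      test_cost_cong[OF *, of M] by auto
next
  case (While_False b s c)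
  have *: "\<forall>x \<in> test_vars b. s x = z x" using While_False.prems by auto
  show ?case
    using exec.While_False[of b z M c] While_False eval_test_cong[OF *]
      test_cost_cong[OF *, of M] by auto
next
  case (While_True b s c t s' t' s'')
  have *: "\<forall>x \<in> test_vars b. s x = z x" using While_True.prems by auto
  from While_True.IH(1)[of z] While_True.prems obtain z1 where
    1: "exec M c z t z1" "\<forall>x \<in> X. z1 x = s' x" "\<forall>x. x \<notin> X \<longrightarrow> z1 x = z x" by auto
  from While_True.IH(2)[of z1] While_True.prems 1(2) obtain z2 where
    2: "exec M (While b c) z1 t' z2" "\<forall>x \<in> X. z2 x = s'' x" "\<forall>x. x \<notin> X \<longrightarrow> z2 x = z1 x" by auto
  have "exec M (While b c) z (test_cost M b s + t + t') z2"
    using exec.While_True[OF _ 1(1) 2(1)] While_True.hyps(1) eval_test_cong[OF *]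
      test_cost_cong[OF *, of M] by auto
  with 1 2 show ?case by metis
qed

lemma num_size_pos: "0 < num_size M r"
  by (cases M) (auto simp: Let_def split_def)

lemma val_size_pos: "0 < val_size M v"
  by (cases v) (simp_all add: num_size_pos Suc_leI)

lemma val_size_eval_exp_le: "val_size M (eval_exp a s) \<le> exp_cost M a s"
  by (cases a) (simp_all del: eval_exp.simps)

text \<open>The cost of an expression includes the size of its result, so whatever an assignment
  stores has already been charged to the running time.\<close>

lemma exec_val_size: "exec M c s t s' \<Longrightarrow> val_size M (s' x) \<le> val_size M (s x) + t"
proof (induction rule: exec.induct)
  case (Assign y a s)
  show ?case using val_size_eval_exp_le[of M a s] by auto
qed linarith+

section \<open>Polynomial time bounds and their composition\<close>

lemma poly_nat_mono: "m \<le> n \<Longrightarrow> poly p m \<le> poly p (n :: nat)"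
  by (induction p) (auto intro!: add_mono mult_mono)


text \<open>The command may overwrite the variables from \<open>N\<close> on, whatever they hold: this is what lets
  commands be composed without renaming.\<close>

definition polytime :: "cost_model \<Rightarrow> (val \<Rightarrow> val) \<Rightarrow> bool" where
  "polytime M f \<longleftrightarrow> (\<forall>N. \<forall>a<N. \<forall>b<N. \<exists>c p. \<forall>s. \<exists>t s'. exec M c s t s' \<and>
     t \<le> poly p (val_size M (s a)) \<and> s' b = f (s a) \<and> (\<forall>z<N. z \<noteq> b \<longrightarrow> s' z = s z))"

lemma polytimeI:
  assumes "\<And>N a b. a < N \<Longrightarrow> b < N \<Longrightarrow> \<exists>c p. \<forall>s. \<exists>t s'. exec M c s t s' \<and>
     t \<le> poly p (val_size M (s a)) \<and> s' b = f (s a) \<and> (\<forall>z<N. z \<noteq> b \<longrightarrow> s' z = s z)"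
  shows "polytime M f"
  using assms unfolding polytime_def by blast

lemma polytimeE:
  assumes "polytime M f" "a < N" "b < N"
  obtains c p where "\<And>s. \<exists>t s'. exec M c s t s' \<and>
     t \<le> poly p (val_size M (s a)) \<and> s' b = f (s a) \<and> (\<forall>z<N. z \<noteq> b \<longrightarrow> s' z = s z)"
  using assms unfolding polytime_def by (metis (no_types, lifting))

text \<open>In a composition the second program is charged in terms of the size of the intermediate
  value, so that size needs a polynomial bound too; the running time provides it.\<close>

lemma polytime_val_size:
  assumes "polytime M f"
  obtains q where "\<And>v. val_size M (f v) \<le> poly q (val_size M v)"
proof -
  from polytimeE[OF assms, of 0 2 1] obtain c p where
    *: "\<And>s. \<exists>t s'. exec M c s t s' \<and> t \<le> poly p (val_size M (s 0)) \<and> s' 1 = f (s 0)"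
    by (metis one_less_numeral_iff pos2 semiring_norm(76))
  \<comment> \<open>The summand 1 is the size of the \<open>VNil\<close> in the output variable
    before the run.\<close>
  have "val_size M (f v) \<le> poly ([:1:] + p) (val_size M v)" for v
  proof -
    from *[of "(\<lambda>_. VNil)(0 := v)"] obtain t s' where
      "exec M c ((\<lambda>_. VNil)(0 := v)) t s'" "t \<le> poly p (val_size M v)" "s' 1 = f v"
      by auto
    with exec_val_size[OF this(1), of 1] show ?thesis by simp
  qed
  then show ?thesis by (rule that)
qed

lemma polytime_id: "polytime M (\<lambda>v. v)"
proof (rule polytimeI)
  fix N a b :: nat
  have "\<forall>s. \<exists>t s'. exec M (Assign b (Var a)) s t s' \<and>
     t \<le> poly [:1,1:] (val_size M (s a)) \<and> s' b = s a \<and> (\<forall>z<N. z \<noteq> b \<longrightarrow> s' z = s z)"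
    using exec.Assign[of M b "Var a"] by fastforce
  then show "\<exists>c p. \<forall>s. \<exists>t s'. exec M c s t s' \<and>
     t \<le> poly p (val_size M (s a)) \<and> s' b = s a \<and> (\<forall>z<N. z \<noteq> b \<longrightarrow> s' z = s z)" by blast
qed

lemma polytime_nil: "polytime M (\<lambda>v. VNil)"
proof (rule polytimeI)
  fix N a b :: nat
  have "\<forall>s. \<exists>t s'. exec M (Assign b Empty) s t s' \<and>
     t \<le> poly [:2:] (val_size M (s a)) \<and> s' b = VNil \<and> (\<forall>z<N. z \<noteq> b \<longrightarrow> s' z = s z)"
    using exec.Assign[of M b "Empty"] by fastforce
  then show "\<exists>c p. \<forall>s. \<exists>t s'. exec M c s t s' \<and>
     t \<le> poly p (val_size M (s a)) \<and> s' b = VNil \<and> (\<forall>z<N. z \<noteq> b \<longrightarrow> s' z = s z)" by blast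
qed

lemma val_size_the_fst: "val_size M (the_fst v) \<le> val_size M v"
  by (cases v) (simp_all add: num_size_pos Suc_leI)

lemma val_size_the_snd: "val_size M (the_snd v) \<le> val_size M v"
  by (cases v) (simp_all add: num_size_pos Suc_leI)

text \<open>The intermediate value goes to variable \<open>N\<close>, the first one that may be
  overwritten. Both commands are taken for \<open>Suc N\<close> variables, so the first one delivers
  its result there and touches nothing below.\<close>

lemma polytime_comp:
  assumes "polytime M f" "polytime M g"
  shows "polytime M (\<lambda>v. g (f v))"
proof (rule polytimeI)
  fix N a b :: nat
  assume N: "a < N" "b < N"
  obtain q where q: "\<And>v. val_size M (f v) \<le> poly q (val_size M v)"
    using polytime_val_size[OF assms(1)] by blast
  obtain c p where c: "\<And>s. \<exists>t s'. exec M c s t s' \<and> t \<le> poly p (val_size M (s a)) \<and>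
      s' N = f (s a) \<and> (\<forall>z<Suc N. z \<noteq> N \<longrightarrow> s' z = s z)"
    by (rule polytimeE[OF assms(1), of a "Suc N" N]) (use N in auto)
  obtain d r where d: "\<And>s. \<exists>t s'. exec M d s t s' \<and> t \<le> poly r (val_size M (s N)) \<and>
      s' b = g (s N) \<and> (\<forall>z<Suc N. z \<noteq> b \<longrightarrow> s' z = s z)"
    by (rule polytimeE[OF assms(2), of N "Suc N" b]) (use N in auto)
  have "\<exists>t s'. exec M (Seq c d) s t s' \<and> t \<le> poly (p + pcompose r q) (val_size M (s a)) \<and>
      s' b = g (f (s a)) \<and> (\<forall>z<N. z \<noteq> b \<longrightarrow> s' z = s z)" for s
  proof -
    obtain t1 s1 where 1: "exec M c s t1 s1" "t1 \<le> poly p (val_size M (s a))"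
      "s1 N = f (s a)" "\<forall>z<Suc N. z \<noteq> N \<longrightarrow> s1 z = s z" using c by blast
    obtain t2 s2 where 2: "exec M d s1 t2 s2" "t2 \<le> poly r (val_size M (s1 N))"
      "s2 b = g (s1 N)" "\<forall>z<Suc N. z \<noteq> b \<longrightarrow> s2 z = s1 z" using d by blast
    have "t2 \<le> poly r (poly q (val_size M (s a)))"
      using 2(2) 1(3) poly_nat_mono[OF q, of r "s a"] by simp
    then have "t1 + t2 \<le> poly (p + pcompose r q) (val_size M (s a))"
      using 1(2) by (simp add: poly_pcompose)
    moreover have "\<forall>z<N. z \<noteq> b \<longrightarrow> s2 z = s z" using 1 2 by auto
    ultimately show ?thesis using exec.Seq[OF 1(1) 2(1)] 1(3) 2(3) by metis
  qed
  then show "\<exists>c p. \<forall>s. \<exists>t s'. exec M c s t s' \<and> t \<le> poly p (val_size M (s a)) \<and>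
      s' b = g (f (s a)) \<and> (\<forall>z<N. z \<noteq> b \<longrightarrow> s' z = s z)" by blast
qed

lemma polytime_fst:
  assumes "polytime M f"
  shows "polytime M (\<lambda>v. the_fst (f v))"
proof (rule polytime_comp[OF assms, of the_fst], rule polytimeI)
  fix N a b :: nat
  have "\<exists>t s'. exec M (Assign b (Fst (Var a))) s t s' \<and> t \<le> poly [:1,2:] (val_size M (s a)) \<and>
     s' b = the_fst (s a) \<and> (\<forall>z<N. z \<noteq> b \<longrightarrow> s' z = s z)" for s
    by (rule exI, rule exI, rule conjI, rule exec.Assign)
      (use val_size_the_fst[of M "s a"] in auto)
  then show "\<exists>c p. \<forall>s. \<exists>t s'. exec M c s t s' \<and> t \<le> poly p (val_size M (s a)) \<and>
     s' b = the_fst (s a) \<and> (\<forall>z<N. z \<noteq> b \<longrightarrow> s' z = s z)" by blast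
qed

lemma polytime_snd:
  assumes "polytime M f"
  shows "polytime M (\<lambda>v. the_snd (f v))"
proof (rule polytime_comp[OF assms, of the_snd], rule polytimeI)
  fix N a b :: nat
  have "\<exists>t s'. exec M (Assign b (Snd (Var a))) s t s' \<and> t \<le> poly [:1,2:] (val_size M (s a)) \<and>
     s' b = the_snd (s a) \<and> (\<forall>z<N. z \<noteq> b \<longrightarrow> s' z = s z)" for s
    by (rule exI, rule exI, rule conjI, rule exec.Assign)
      (use val_size_the_snd[of M "s a"] in auto)
  then show "\<exists>c p. \<forall>s. \<exists>t s'. exec M c s t s' \<and> t \<le> poly p (val_size M (s a)) \<and>
     s' b = the_snd (s a) \<and> (\<forall>z<N. z \<noteq> b \<longrightarrow> s' z = s z)" by blast
qed

text \<open>The common pattern of binary operations: the arguments are computed into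
  \<open>N\<close> and \<open>Suc N\<close> from the same input. Taking both commands for
  \<open>N+2\<close> variables keeps the input and the first result alive while the second is
  computed; \<open>body\<close> may then destroy both results.\<close>

lemma polytime_eval2:
  assumes f: "polytime M f" and g: "polytime M g"
    and body: "\<And>N b. b < N \<Longrightarrow> \<exists>c p. \<forall>s. \<exists>t s'. exec M c s t s' \<and>
      t \<le> poly p (val_size M (s N) + val_size M (s (Suc N))) \<and> s' b = h (s N) (s (Suc N)) \<and>
      (\<forall>z<N. z \<noteq> b \<longrightarrow> s' z = s z)"
  shows "polytime M (\<lambda>v. h (f v) (g v))"
proof (rule polytimeI)
  fix N a b :: nat
  assume N: "a < N" "b < N"
  obtain q where q: "\<And>v. val_size M (f v) \<le> poly q (val_size M v)"
    using polytime_val_size[OF f] by blast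
  obtain r where r: "\<And>v. val_size M (g v) \<le> poly r (val_size M v)"
    using polytime_val_size[OF g] by blast
  obtain cf pf where cf: "\<And>s. \<exists>t s'. exec M cf s t s' \<and> t \<le> poly pf (val_size M (s a)) \<and>
      s' N = f (s a) \<and> (\<forall>z<N+2. z \<noteq> N \<longrightarrow> s' z = s z)"
    by (rule polytimeE[OF f, of a "N+2" N]) (use N in auto)
  obtain cg pg where cg: "\<And>s. \<exists>t s'. exec M cg s t s' \<and> t \<le> poly pg (val_size M (s a)) \<and>
      s' (Suc N) = g (s a) \<and> (\<forall>z<N+2. z \<noteq> Suc N \<longrightarrow> s' z = s z)"
    by (rule polytimeE[OF g, of a "N+2" "Suc N"]) (use N in auto)
  obtain c p where c: "\<And>s. \<exists>t s'. exec M c s t s' \<and>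
      t \<le> poly p (val_size M (s N) + val_size M (s (Suc N))) \<and> s' b = h (s N) (s (Suc N)) \<and>
      (\<forall>z<N. z \<noteq> b \<longrightarrow> s' z = s z)"
    using body[OF N(2)] by blast
  let ?p = "pf + pg + pcompose p (q + r)"
  have "\<exists>t s'. exec M (Seq cf (Seq cg c)) s t s' \<and> t \<le> poly ?p (val_size M (s a)) \<and>
      s' b = h (f (s a)) (g (s a)) \<and> (\<forall>z<N. z \<noteq> b \<longrightarrow> s' z = s z)" for s
  proof -
    obtain t1 s1 where 1: "exec M cf s t1 s1" "t1 \<le> poly pf (val_size M (s a))"
      "s1 N = f (s a)" "\<forall>z<N+2. z \<noteq> N \<longrightarrow> s1 z = s z" using cf by blast
    obtain t2 s2 where 2: "exec M cg s1 t2 s2" "t2 \<le> poly pg (val_size M (s1 a))"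
      "s2 (Suc N) = g (s1 a)" "\<forall>z<N+2. z \<noteq> Suc N \<longrightarrow> s2 z = s1 z" using cg by blast
    obtain t3 s3 where 3: "exec M c s2 t3 s3"
      "t3 \<le> poly p (val_size M (s2 N) + val_size M (s2 (Suc N)))"
      "s3 b = h (s2 N) (s2 (Suc N))" "\<forall>z<N. z \<noteq> b \<longrightarrow> s3 z = s2 z" using c by blast
    have e: "s1 a = s a" "s2 N = f (s a)" "s2 (Suc N) = g (s a)" using 1 2 N by auto
    have "t3 \<le> poly p (poly q (val_size M (s a)) + poly r (val_size M (s a)))"
      using 3(2) poly_nat_mono[OF add_mono[OF q r], of p "s a" "s a"] e by simp
    then have "t1 + (t2 + t3) \<le> poly ?p (val_size M (s a))"
      using 1(2) 2(2) e by (simp add: poly_pcompose)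
    moreover have "\<forall>z<N. z \<noteq> b \<longrightarrow> s3 z = s z" using 1 2 3 by auto
    ultimately show ?thesis using exec.Seq[OF 1(1) exec.Seq[OF 2(1) 3(1)]] 3(3) e by metis
  qed
  then show "\<exists>c p. \<forall>s. \<exists>t s'. exec M c s t s' \<and> t \<le> poly p (val_size M (s a)) \<and>
      s' b = h (f (s a)) (g (s a)) \<and> (\<forall>z<N. z \<noteq> b \<longrightarrow> s' z = s z)" by blast
qed

lemma polytime_pair:
  assumes "polytime M f" "polytime M g"
  shows "polytime M (\<lambda>v. VPair (f v) (g v))"
proof (rule polytime_eval2[OF assms, of VPair])
  fix N b :: nat
  have "\<exists>t s'. exec M (Assign b (Cons (Var N) (Var (Suc N)))) s t s' \<and>
     t \<le> poly [:2,2:] (val_size M (s N) + val_size M (s (Suc N))) \<and>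
     s' b = VPair (s N) (s (Suc N)) \<and> (\<forall>z<N. z \<noteq> b \<longrightarrow> s' z = s z)" for s
    by (rule exI, rule exI, rule conjI, rule exec.Assign) auto
  then show "\<exists>c p. \<forall>s. \<exists>t s'. exec M c s t s' \<and>
     t \<le> poly p (val_size M (s N) + val_size M (s (Suc N))) \<and>
     s' b = VPair (s N) (s (Suc N)) \<and> (\<forall>z<N. z \<noteq> b \<longrightarrow> s' z = s z)" by blast
qed

section \<open>Tests and case distinctions\<close>

fun is_pair :: "val \<Rightarrow> bool" where
  "is_pair (VPair a b) = True"
| "is_pair _ = False"

lemma is_pair_iff: "is_pair v \<longleftrightarrow> (\<exists>a b. v = VPair a b)"
  by (cases v) auto

text \<open>Truth is a pair because \<open>Is_Pair\<close> is the test by which programs branch on a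
  stored value.\<close>

definition of_bool_val :: "bool \<Rightarrow> val" where
  "of_bool_val P = (if P then VPair VNil VNil else VNil)"

lemma is_pair_of_bool_val [simp]: "is_pair (of_bool_val P) = P"
  by (simp add: of_bool_val_def)

definition polytest :: "cost_model \<Rightarrow> (val \<Rightarrow> bool) \<Rightarrow> bool" where
  "polytest M P \<longleftrightarrow> polytime M (\<lambda>v. of_bool_val (P v))"

lemma polytest_less:
  assumes "polytime M f" "polytime M g"
  shows "polytest M (\<lambda>v. the_num (f v) < the_num (g v))"
  unfolding polytest_def
proof (rule polytime_eval2[OF assms, of "\<lambda>x y. of_bool_val (the_num x < the_num y)"])
  fix N b :: nat
  let ?c = "If (Less (Var N) (Var (Suc N))) (Assign b (Cons Empty Empty)) (Assign b Empty)"
  have "\<exists>t s'. exec M ?c s t s' \<and>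
     t \<le> poly [:7,1:] (val_size M (s N) + val_size M (s (Suc N))) \<and>
     s' b = of_bool_val (the_num (s N) < the_num (s (Suc N))) \<and>
     (\<forall>z<N. z \<noteq> b \<longrightarrow> s' z = s z)" for s
  proof (cases "the_num (s N) < the_num (s (Suc N))")
    case True
    show ?thesis
      by (rule exI, rule exI, rule conjI, rule exec.If_True, use True in simp, rule exec.Assign)
        (use True in \<open>auto simp: of_bool_val_def\<close>)
  next
    case False
    show ?thesis
      by (rule exI, rule exI, rule conjI, rule exec.If_False, use False in simp, rule exec.Assign)
        (use False in \<open>auto simp: of_bool_val_def\<close>)
  qed
  then show "\<exists>c p. \<forall>s. \<exists>t s'. exec M c s t s' \<and>
     t \<le> poly p (val_size M (s N) + val_size M (s (Suc N))) \<and>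
     s' b = of_bool_val (the_num (s N) < the_num (s (Suc N))) \<and>
     (\<forall>z<N. z \<noteq> b \<longrightarrow> s' z = s z)" by blast
qed

lemma polytime_if_pair:
  assumes f: "polytime M f" and g: "polytime M g" and h: "polytime M h"
  shows "polytime M (\<lambda>v. if is_pair (f v) then g v else h v)"
proof -
  text \<open>Both branches are evaluated, so that the choice is between two stored values.\<close>
  have *: "polytime M (\<lambda>v. (\<lambda>x y. if is_pair x then the_fst y else the_snd y)
     (f v) (VPair (g v) (h v)))"
  proof (rule polytime_eval2[OF f polytime_pair[OF g h],
        of "\<lambda>x y. if is_pair x then the_fst y else the_snd y"])
    fix N b :: nat
    let ?c = "If (Is_Pair (Var N)) (Assign b (Fst (Var (Suc N)))) (Assign b (Snd (Var (Suc N))))"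
    have "\<exists>t s'. exec M ?c s t s' \<and>
     t \<le> poly [:2,2:] (val_size M (s N) + val_size M (s (Suc N))) \<and>
     s' b = (if is_pair (s N) then the_fst (s (Suc N)) else the_snd (s (Suc N))) \<and>
     (\<forall>z<N. z \<noteq> b \<longrightarrow> s' z = s z)" for s
    proof (cases "is_pair (s N)")
      case True
      show ?thesis
        by (rule exI, rule exI, rule conjI, rule exec.If_True, use True in \<open>simp add: is_pair_iff\<close>,
            rule exec.Assign)
          (use True val_size_the_fst[of M "s (Suc N)"] in \<open>auto simp: is_pair_iff\<close>)
    next
      case False
      show ?thesis
        by (rule exI, rule exI, rule conjI, rule exec.If_False, use False in \<open>simp add: is_pair_iff\<close>,
            rule exec.Assign)
          (use False val_size_the_snd[of M "s (Suc N)"] in \<open>auto simp: is_pair_iff\<close>)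
    qed
    then show "\<exists>c p. \<forall>s. \<exists>t s'. exec M c s t s' \<and>
     t \<le> poly p (val_size M (s N) + val_size M (s (Suc N))) \<and>
     s' b = (if is_pair (s N) then the_fst (s (Suc N)) else the_snd (s (Suc N))) \<and>
     (\<forall>z<N. z \<noteq> b \<longrightarrow> s' z = s z)" by blast
  qed
  then show ?thesis by (simp cong: if_cong)
qed

lemma polytime_if:
  assumes "polytest M P" "polytime M g" "polytime M h"
  shows "polytime M (\<lambda>v. if P v then g v else h v)"
  using polytime_if_pair[OF assms(1)[unfolded polytest_def] assms(2,3)] by simp

lemma polytest_pair:
  assumes "polytime M f"
  shows "polytest M (\<lambda>v. is_pair (f v))"
  unfolding polytest_def of_bool_val_def
  by (intro polytime_if_pair polytime_pair polytime_nil assms)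

lemma polytest_not:
  assumes "polytest M P"
  shows "polytest M (\<lambda>v. \<not> P v)"
proof -
  have "polytime M (\<lambda>v. if P v then VNil else VPair VNil VNil)"
    by (intro polytime_if polytime_pair polytime_nil assms)
  moreover have "(\<lambda>v. if P v then VNil else VPair VNil VNil) = (\<lambda>v. of_bool_val (\<not> P v))"
    by (auto simp: of_bool_val_def)
  ultimately show ?thesis unfolding polytest_def by simp
qed

lemma polytest_conj:
  assumes "polytest M P" "polytest M Q"
  shows "polytest M (\<lambda>v. P v \<and> Q v)"
proof -
  have "polytime M (\<lambda>v. if P v then of_bool_val (Q v) else VNil)"
    by (rule polytime_if[OF assms(1) assms(2)[unfolded polytest_def] polytime_nil])
  moreover have "(\<lambda>v. if P v then of_bool_val (Q v) else VNil) = (\<lambda>v. of_bool_val (P v \<and> Q v))"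
    by (auto simp: of_bool_val_def)
  ultimately show ?thesis unfolding polytest_def by simp
qed

lemma polytest_disj:
  assumes "polytest M P" "polytest M Q"
  shows "polytest M (\<lambda>v. P v \<or> Q v)"
  using polytest_not[OF polytest_conj[OF polytest_not[OF assms(1)] polytest_not[OF assms(2)]]]
  by simp

section \<open>Loops over lists\<close>

fun the_list :: "val \<Rightarrow> val list" where
  "the_list (VPair x l) = x # the_list l"
| "the_list _ = []"

lemma the_list_enc_list [simp]: "the_list (enc_list xs) = xs"
  by (induction xs) auto

lemma is_pair_enc_list [simp]: "is_pair (enc_list xs) \<longleftrightarrow> xs \<noteq> []"
  by (cases xs) auto

text \<open>Each round moves one cell from \<open>Q\<close> to \<open>A\<close>, which leaves the
  sum of the two sizes unchanged; so \<open>B\<close> remains a bound. A round costs at most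
  \<open>10 * B\<close>, and the size of \<open>Q\<close> bounds the number of rounds. A list ending
  in a number instead of \<open>VNil\<close> just stops the loop, in agreement with
  \<open>the_list\<close>.\<close>

lemma exec_append_loop:
  assumes PQ: "Q \<noteq> A" and "s A = enc_list acc" and "val_size M (s Q) + val_size M (s A) \<le> B"
  shows "\<exists>t s'. exec M (While (Is_Pair (Var Q)) (Seq (Assign A (Cons (Fst (Var Q)) (Var A)))
        (Assign Q (Snd (Var Q))))) s t s' \<and>
      t \<le> 10 * val_size M (s Q) * B \<and>
      s' A = enc_list (rev (the_list (s Q)) @ acc) \<and> val_size M (s' A) \<le> B \<and>
      (\<forall>z. z \<noteq> A \<and> z \<noteq> Q \<longrightarrow> s' z = s z)"
  using assms(2,3)
proof (induction "s Q" arbitrary: s acc)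
  case (VPair x q)
  let ?c = "Seq (Assign A (Cons (Fst (Var Q)) (Var A))) (Assign Q (Snd (Var Q)))"
  let ?W = "While (Is_Pair (Var Q)) ?c"
  let ?s1 = "s(A := VPair x (s A))" and ?s2 = "s(A := VPair x (s A), Q := q)"
  have sQ: "s Q = VPair x q" using VPair.hyps(3) by simp
  have e: "eval_exp (Cons (Fst (Var Q)) (Var A)) s = VPair x (s A)"
    "eval_exp (Snd (Var Q)) ?s1 = q" using sQ PQ by auto
  have c1: "exec M (Assign A (Cons (Fst (Var Q)) (Var A))) s
      (1 + exp_cost M (Cons (Fst (Var Q)) (Var A)) s) ?s1"
    using exec.Assign[of M A "Cons (Fst (Var Q)) (Var A)" s] unfolding e(1) .
  have c2: "exec M (Assign Q (Snd (Var Q))) ?s1 (1 + exp_cost M (Snd (Var Q)) ?s1) ?s2"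
    using exec.Assign[of M Q "Snd (Var Q)" ?s1] unfolding e(2) .
  note c = exec.Seq[OF c1 c2]
  have "q = ?s2 Q" "?s2 A = enc_list (x # acc)"
    "val_size M (?s2 Q) + val_size M (?s2 A) \<le> B" using VPair.prems sQ PQ by auto
  from VPair.hyps(2)[OF this] obtain t s' where IH: "exec M ?W ?s2 t s'"
    "t \<le> 10 * val_size M (?s2 Q) * B" "s' A = enc_list (rev (the_list (?s2 Q)) @ x # acc)"
    "val_size M (s' A) \<le> B" "\<forall>z. z \<noteq> A \<and> z \<noteq> Q \<longrightarrow> s' z = ?s2 z"
    by blast
  let ?t = "test_cost M (Is_Pair (Var Q)) s +
    (1 + exp_cost M (Cons (Fst (Var Q)) (Var A)) s + (1 + exp_cost M (Snd (Var Q)) ?s1)) + t"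
  have "exec M ?W s ?t s'"
    by (rule exec.While_True[OF _ c IH(1)]) (use sQ in simp)
  moreover have "?t \<le> 10 * val_size M (s Q) * B"
  proof -
    \<comment> \<open>One round evaluates seven expressions and subexpressions with values of size
      at most \<open>B\<close> and pays 1 for the test and for each of the two assignments; hence
      the factor 10.\<close>
    have "?t \<le> 10 * B + t" using VPair.prems(2) sQ PQ val_size_pos[of M x] val_size_pos[of M q]
        val_size_pos[of M "s A"] by simp
    also have "\<dots> \<le> 10 * B + 10 * val_size M q * B" using IH(2) by simp
    also have "\<dots> \<le> 10 * val_size M (s Q) * B" using sQ by (simp add: algebra_simps)
    finally show ?thesis .
  qed
  ultimately show ?case using IH sQ by (intro exI[of _ ?t] exI[of _ s']) simp
next
  case VNil
  have "val_size M (s Q) + val_size M (s A) \<le> B" using VNil by simp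
  moreover have "s Q = VNil" using VNil by simp
  ultimately show ?case using VNil(2)
    by (intro exI[of _ "test_cost M (Is_Pair (Var Q)) s"] exI[of _ s])
      (use exec.While_False[of "Is_Pair (Var Q)" s M "Seq (Assign A (Cons (Fst (Var Q)) (Var A)))
        (Assign Q (Snd (Var Q)))"] in auto)
next
  case (VNum r)
  have *: "val_size M (s Q) + val_size M (s A) \<le> B" "s Q = VNum r" using VNum by simp_all
  have "1 + val_size M (s Q) \<le> 10 * val_size M (s Q) * B"
  proof -
    have "1 + val_size M (s Q) \<le> B" using * val_size_pos[of M "s A"] by simp
    also have "B \<le> 10 * val_size M (s Q) * B" using val_size_pos[of M "s Q"] by simp
    finally show ?thesis .
  qed
  with * VNum(2) show ?case
    by (intro exI[of _ "test_cost M (Is_Pair (Var Q)) s"] exI[of _ s])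
      (use exec.While_False[of "Is_Pair (Var Q)" s M "Seq (Assign A (Cons (Fst (Var Q)) (Var A)))
        (Assign Q (Snd (Var Q)))"] in auto)
qed

text \<open>The result is reversed because the loop pushes the produced elements onto an accumulator.\<close>

lemma polytime_rev_flatmap:
  assumes f: "polytime M f" and g: "polytime M g"
  shows "polytime M (\<lambda>v. enc_list (rev (concat (map (\<lambda>x. the_list (f (VPair v x))) (the_list (g v))))))"
    (is "polytime M ?F")
proof (rule polytimeI)
  fix N a b :: nat
  assume N: "a < N" "b < N"
  \<comment> \<open>These hold the remaining input list, the accumulator, the argument of
    \<open>f\<close>, and the list that \<open>f\<close> produced for the current element.\<close>
  define L A P Q where "L = N" and "A = N + 1" and "P = N + 2" and "Q = N + 3"
  note vars = L_def A_def P_def Q_def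
  obtain qf where qf: "\<And>v. val_size M (f v) \<le> poly qf (val_size M v)"
    using polytime_val_size[OF f] by blast
  obtain qg where qg: "\<And>v. val_size M (g v) \<le> poly qg (val_size M v)"
    using polytime_val_size[OF g] by blast
  obtain cf pf where cf: "\<And>s. \<exists>t s'. exec M cf s t s' \<and> t \<le> poly pf (val_size M (s P)) \<and>
      s' Q = f (s P) \<and> (\<forall>z<N+4. z \<noteq> Q \<longrightarrow> s' z = s z)"
    by (rule polytimeE[OF f, of P "N+4" Q]) (use N in \<open>auto simp: vars\<close>)
  obtain cg pg where cg: "\<And>s. \<exists>t s'. exec M cg s t s' \<and> t \<le> poly pg (val_size M (s a)) \<and>
      s' L = g (s a) \<and> (\<forall>z<N+4. z \<noteq> L \<longrightarrow> s' z = s z)"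
    by (rule polytimeE[OF g, of a "N+4" L]) (use N in \<open>auto simp: vars\<close>)
  let ?inner = "While (Is_Pair (Var Q)) (Seq (Assign A (Cons (Fst (Var Q)) (Var A)))
        (Assign Q (Snd (Var Q))))"
  let ?body = "Seq (Assign P (Cons (Var a) (Fst (Var L)))) (Seq cf (Seq ?inner
        (Assign L (Snd (Var L)))))"
  let ?W = "While (Is_Pair (Var L)) ?body"
  \<comment> \<open>\<open>K\<close> bounds the argument of \<open>f\<close> in every round, and
    \<open>Z\<close> the value of \<open>f\<close> there. The condition on \<open>H\<close> reserves
    \<open>Z\<close> for each remaining unit of the size of \<open>l\<close>: a round adds at most
    \<open>Z\<close> to the accumulator while that size drops.\<close>
  have loop: "\<exists>t s'. exec M ?W s t s' \<and> t \<le> val_size M l * (10 * K + poly pf K + 10 * Z * H) \<and>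
      s' A = enc_list (rev (concat (map (\<lambda>x. the_list (f (VPair v x))) (the_list l))) @ acc) \<and>
      val_size M (s' A) \<le> H \<and> (\<forall>z<N. s' z = s z)"
    if "s L = l" "s a = v" "s A = enc_list acc" "val_size M l + val_size M v + 1 \<le> K"
      "Z = poly qf K" "val_size M (s A) + val_size M l * Z \<le> H" for s l v acc K Z H
    using that
  proof (induction l arbitrary: s acc)
    case (VPair x l)
    let ?D = "10 * K + poly pf K + 10 * Z * H"
    define s1 where "s1 = s(P := VPair v x)"
    have 1: "exec M (Assign P (Cons (Var a) (Fst (Var L)))) s
        (1 + exp_cost M (Cons (Var a) (Fst (Var L))) s) s1"
      using exec.Assign[of M P "Cons (Var a) (Fst (Var L))" s] VPair.prems(1,2)
      by (simp add: s1_def)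
    obtain t2 s2 where 2: "exec M cf s1 t2 s2" "t2 \<le> poly pf (val_size M (s1 P))"
      "s2 Q = f (s1 P)" "\<forall>z<N+4. z \<noteq> Q \<longrightarrow> s2 z = s1 z" using cf by blast
    have K: "val_size M (VPair v x) \<le> K" using VPair.prems(4) by simp
    have t2: "t2 \<le> poly pf K" using 2(2) poly_nat_mono[OF K, of pf] by (simp add: s1_def)
    have s2Q: "s2 Q = f (VPair v x)" using 2(3) by (simp add: s1_def)
    have Z: "val_size M (s2 Q) \<le> Z"
      using qf[of "VPair v x"] poly_nat_mono[OF K, of qf] VPair.prems(5) s2Q by simp
    have s2: "s2 A = s A" "s2 L = s L" "\<forall>z<N. s2 z = s z" using 2(4) by (auto simp: s1_def vars)
    let ?B = "val_size M (s2 Q) + val_size M (s2 A)"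
    have B: "?B + val_size M l * Z \<le> H" "?B \<le> H"
      using VPair.prems(6) Z s2 by (simp_all add: algebra_simps)
    have "Q \<noteq> A" by (simp add: vars)
    moreover have "s2 A = enc_list acc" using s2 VPair.prems by simp
    ultimately obtain t3 s3 where 3: "exec M ?inner s2 t3 s3"
      "t3 \<le> 10 * val_size M (s2 Q) * ?B" "s3 A = enc_list (rev (the_list (s2 Q)) @ acc)"
      "val_size M (s3 A) \<le> ?B" "\<forall>z. z \<noteq> A \<and> z \<noteq> Q \<longrightarrow> s3 z = s2 z"
      using exec_append_loop[of Q A s2 acc M ?B] by blast
    have t3: "t3 \<le> 10 * Z * H"
      by (rule order_trans[OF 3(2)], rule mult_le_mono) (use Z B in simp_all)
    have s3L: "s3 L = VPair x l" using 3(5) s2 VPair.prems(1) by (simp add: vars)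
    define s4 where "s4 = s3(L := l)"
    have 4: "exec M (Assign L (Snd (Var L))) s3 (1 + exp_cost M (Snd (Var L)) s3) s4"
      using exec.Assign[of M L "Snd (Var L)" s3] s3L by (simp add: s4_def)
    have s4: "s4 L = l" "s4 A = enc_list (rev (the_list (f (VPair v x))) @ acc)" "s4 A = s3 A"
      "\<forall>z<N. s4 z = s z"
      using 3(3,5) s2 s2Q by (auto simp: s4_def vars)
    have "s4 a = v" "val_size M l + val_size M v + 1 \<le> K" "val_size M (s4 A) + val_size M l * Z \<le> H"
      using s4 N VPair.prems B 3(4) by auto
    from VPair.IH(2)[OF s4(1) this(1) s4(2) this(2) VPair.prems(5) this(3)] obtain t5 s5 where
      5: "exec M ?W s4 t5 s5" "t5 \<le> val_size M l * ?D"
      "s5 A = enc_list (rev (concat (map (\<lambda>x. the_list (f (VPair v x))) (the_list l))) @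
        rev (the_list (f (VPair v x))) @ acc)"
      "val_size M (s5 A) \<le> H" "\<forall>z<N. s5 z = s4 z" by blast
    let ?t = "test_cost M (Is_Pair (Var L)) s + (1 + exp_cost M (Cons (Var a) (Fst (Var L))) s +
      (t2 + (t3 + (1 + exp_cost M (Snd (Var L)) s3)))) + t5"
    have "exec M ?W s ?t s5"
      by (rule exec.While_True[OF _ exec.Seq[OF 1 exec.Seq[OF 2(1) exec.Seq[OF 3(1) 4]]] 5(1)])
        (use VPair.prems(1) in simp)
    moreover have "?t \<le> val_size M (VPair x l) * ?D"
    proof -
      have "?t \<le> 10 * K + poly pf K + 10 * Z * H + t5"
        using t2 t3 VPair.prems(1,2,4) s3L by simp
      also have "\<dots> \<le> ?D + val_size M l * ?D" using 5(2) by simp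
      also have "\<dots> = (1 + val_size M l) * ?D" by (simp only: add_mult_distrib mult_1)
      also have "\<dots> \<le> val_size M (VPair x l) * ?D" by (rule mult_le_mono1) simp
      finally show ?thesis .
    qed
    ultimately show ?case using 5 s4 by (intro exI[of _ ?t] exI[of _ s5]) simp
  next
    case VNil
    then show ?case
      by (intro exI[of _ "test_cost M (Is_Pair (Var L)) s"] exI[of _ s])
        (use exec.While_False[of "Is_Pair (Var L)" s M ?body] in auto)
  next
    case (VNum r)
    have "1 + val_size M (VNum r) \<le> K" using VNum.prems by simp
    also have "K \<le> val_size M (VNum r) * (10 * K + poly pf K + 10 * Z * H)"
      using val_size_pos[of M "VNum r"] by (cases "val_size M (VNum r)") auto
    finally show ?case using VNum
      by (intro exI[of _ "test_cost M (Is_Pair (Var L)) s"] exI[of _ s])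
        (use exec.While_False[of "Is_Pair (Var L)" s M ?body] in auto)
  qed
  let ?c = "Seq cg (Seq (Assign A Empty) (Seq ?W (Assign b (Var A))))"
  \<comment> \<open>At the input size these polynomials evaluate to the bounds required by
    \<open>loop\<close>. In \<open>H\<close> the 1 is the size of the empty accumulator; in
    \<open>p\<close> the summands follow the four commands of \<open>?c\<close>.\<close>
  define K where "K = qg + [:1, 1:]"
  define Z where "Z = pcompose qf K"
  define H where "H = 1 + qg * Z"
  define p where "p = pg + 2 + qg * (10 * K + pcompose pf K + 10 * Z * H) + 1 + H"
  have "\<exists>t s'. exec M ?c s t s' \<and> t \<le> poly p (val_size M (s a)) \<and>
      s' b = ?F (s a) \<and> (\<forall>z<N. z \<noteq> b \<longrightarrow> s' z = s z)" for s
  proof -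
    let ?n = "val_size M (s a)"
    obtain t1 s1 where 1: "exec M cg s t1 s1" "t1 \<le> poly pg (val_size M (s a))"
      "s1 L = g (s a)" "\<forall>z<N+4. z \<noteq> L \<longrightarrow> s1 z = s z" using cg by blast
    define s2 where "s2 = s1(A := VNil)"
    have 2: "exec M (Assign A Empty) s1 2 s2"
      using exec.Assign[of M A Empty s1] by (simp add: s2_def numeral_2_eq_2)
    have s2: "s2 L = g (s a)" "s2 a = s a" "s2 A = enc_list []" "\<forall>z<N. s2 z = s z"
      using 1 N by (auto simp: s2_def vars)
    let ?D = "10 * poly K ?n + poly pf (poly K ?n) + 10 * poly Z ?n * poly H ?n"
    have K: "val_size M (g (s a)) + val_size M (s a) + 1 \<le> poly K ?n"
      using qg[of "s a"] by (simp add: K_def)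
    have H: "val_size M (s2 A) + val_size M (g (s a)) * poly Z ?n \<le> poly H ?n"
      using qg[of "s a"] by (simp add: s2_def H_def)
    from loop[OF s2(1,2,3) K _ H] obtain t3 s3 where 3: "exec M ?W s2 t3 s3"
      "t3 \<le> val_size M (g (s a)) * ?D" "s3 A = ?F (s a)" "val_size M (s3 A) \<le> poly H ?n"
      "\<forall>z<N. s3 z = s2 z" by (auto simp: Z_def poly_pcompose)
    have 4: "exec M (Assign b (Var A)) s3 (1 + exp_cost M (Var A) s3) (s3(b := s3 A))"
      using exec.Assign[of M b "Var A" s3] by simp
    have "t3 \<le> poly qg ?n * ?D"
      by (rule order_trans[OF 3(2)], rule mult_le_mono1[OF qg])
    then have "t1 + (2 + (t3 + (1 + exp_cost M (Var A) s3))) \<le> poly p ?n"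
      using 1(2) 3(4) by (simp add: p_def poly_pcompose)
    moreover have "exec M ?c s (t1 + (2 + (t3 + (1 + exp_cost M (Var A) s3)))) (s3(b := s3 A))"
      by (rule exec.Seq[OF 1(1) exec.Seq[OF 2 exec.Seq[OF 3(1) 4]]])
    ultimately show ?thesis using 3(3,5) s2(4)
      by (intro exI[of _ "t1 + (2 + (t3 + (1 + exp_cost M (Var A) s3)))"]
          exI[of _ "s3(b := s3 A)"]) simp
  qed
  then show "\<exists>c p. \<forall>s. \<exists>t s'. exec M c s t s' \<and> t \<le> poly p (val_size M (s a)) \<and>
      s' b = ?F (s a) \<and> (\<forall>z<N. z \<noteq> b \<longrightarrow> s' z = s z)" by blast
qed

lemma polytime_rev:
  assumes "polytime M f"
  shows "polytime M (\<lambda>v. enc_list (rev (the_list (f v))))"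
proof -
  have "polytime M (\<lambda>p. VPair (the_snd p) VNil)"
    by (intro polytime_pair polytime_snd polytime_id polytime_nil)
  from polytime_rev_flatmap[OF this assms] show ?thesis by simp
qed

text \<open>A second reversal restores the order. The pair fed to \<open>h\<close> carries the whole
  input next to the element, so that the treatment of an element may depend on data outside the
  list.\<close>

lemma polytime_flatmap:
  assumes "polytime M (\<lambda>p. h (the_fst p) (the_snd p))" "polytime M g"
  shows "polytime M (\<lambda>v. enc_list (concat (map (\<lambda>x. the_list (h v x)) (the_list (g v)))))"
  using polytime_rev[OF polytime_rev_flatmap[OF assms]] by simp

lemma polytime_map:
  assumes "polytime M (\<lambda>p. h (the_fst p) (the_snd p))" "polytime M g"
  shows "polytime M (\<lambda>v. enc_list (map (h v) (the_list (g v))))"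
  using polytime_flatmap[of M "\<lambda>v x. VPair (h v x) VNil" g, OF polytime_pair[OF assms(1) polytime_nil] assms(2)]
  by (simp add: concat_map_singleton)

lemma polytime_filter:
  assumes "polytest M (\<lambda>p. P (the_fst p) (the_snd p))" "polytime M g"
  shows "polytime M (\<lambda>v. enc_list (filter (P v) (the_list (g v))))"
proof -
  have "polytime M (\<lambda>v. enc_list (concat (map (\<lambda>x. the_list (if P v x then VPair x VNil else VNil))
      (the_list (g v)))))"
    by (intro polytime_flatmap polytime_if polytime_pair polytime_snd polytime_id polytime_nil assms)
  moreover have "concat (map (\<lambda>x. the_list (if P v x then VPair x VNil else VNil)) xs) = filter (P v) xs"
    for v xs by (induction xs) auto
  ultimately show ?thesis by simp
qed

text \<open>Append is the flattening of a two-element list of lists, so it needs no loop of its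
  own.\<close>

lemma polytime_append:
  assumes "polytime M f" "polytime M g"
  shows "polytime M (\<lambda>v. enc_list (the_list (f v) @ the_list (g v)))"
proof -
  have "polytime M (\<lambda>v. enc_list (concat (map (\<lambda>x. the_list x)
      (the_list (VPair (f v) (VPair (g v) VNil))))))"
    by (intro polytime_flatmap polytime_pair polytime_snd polytime_id polytime_nil assms)
  then show ?thesis by simp
qed

lemma polytest_bex:
  assumes "polytest M (\<lambda>p. P (the_fst p) (the_snd p))" "polytime M g"
  shows "polytest M (\<lambda>v. \<exists>x \<in> set (the_list (g v)). P v x)"
  using polytest_pair[OF polytime_filter[OF assms]] by (simp add: filter_empty_conv)

section \<open>Trees and costs\<close>

text \<open>The new vertex has \<open>s\<close> as its only neighbour, whereas a vertex on a cycle
  has two different ones, by distinctness and length at least 3. So the cycle avoids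
  \<open>t\<close> and with it the new edge.\<close>

lemma cycle_add_leaf:
  assumes t: "t \<notin> W" and s: "s \<in> W" and F: "\<forall>e \<in> F. e \<subseteq> W"
    and cyc: "cycle \<lparr>verts = insert t W, edges = insert {s, t} F\<rparr> p"
  shows "cycle \<lparr>verts = W, edges = F\<rparr> p"
proof -
  let ?E = "\<lambda>u v. {u, v} \<in> insert {s, t} F"
  have p: "p \<noteq> []" "set p \<subseteq> insert t W" "successively ?E p" "distinct p" "3 \<le> length p"
    "?E (last p) (hd p)"
    using cyc by (auto simp: cycle_def walk_def)
  have nb: "v = s" if "?E t v \<or> ?E v t" for v
    using that t F by (auto simp: doubleton_eq_iff)
  have "t \<notin> set p"
  proof
    assume "t \<in> set p"
    then obtain a b where ab: "p = a @ t # b" by (metis split_list)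
    \<comment> \<open>If \<open>t\<close> comes first, its second neighbour on the cycle is the last
      vertex, reached by the closing edge; the case that \<open>t\<close> comes last is
      symmetric.\<close>
    have "a = [] \<Longrightarrow> False"
    proof -
      assume a: "a = []"
      then have b: "b \<noteq> []" "tl b \<noteq> []" using p(5) ab by (cases b; auto)+
      have "hd b = s" "last b = s" using p(3,6) nb ab a b by (auto simp: successively_Cons)
      then show False using b p(4) ab by (cases b) (auto split: if_splits)
    qed
    moreover have "b = [] \<Longrightarrow> False"
    proof -
      assume b: "b = []"
      then have a: "a \<noteq> []" "tl a \<noteq> []" using p(5) ab by (cases a; auto)+
      have "hd a = s" "last a = s" using p(3,6) nb ab a b by (auto simp: successively_append_iff)
      then show False using a p(4) ab by (cases a) (auto split: if_splits)
    qed
    moreover have False if "a \<noteq> []" "b \<noteq> []"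
    proof -
      have "last a = s" "hd b = s"
        using that p(3) nb ab by (auto simp: successively_append_iff successively_Cons)
      then have "s \<in> set a \<inter> set b" using that by (metis IntI hd_in_set last_in_set)
      then show False using p(4) ab by auto
    qed
    ultimately show False by blast
  qed
  then have in_F: "?E u v \<Longrightarrow> {u, v} \<in> F" if "u \<in> set p" "v \<in> set p" for u v
    using that by (auto simp: doubleton_eq_iff)
  have "successively (\<lambda>u v. {u, v} \<in> F) p"
    using p(3) by (rule successively_mono) (use in_F in auto)
  moreover have "{last p, hd p} \<in> F" using in_F[of "last p" "hd p"] p(1,6) by simp
  ultimately show ?thesis using p \<open>t \<notin> set p\<close> by (auto simp: cycle_def walk_def)
qed

lemma walk_mono:
  assumes "walk \<lparr>verts = W, edges = F\<rparr> p" "W \<subseteq> W'" "F \<subseteq> F'"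
  shows "walk \<lparr>verts = W', edges = F'\<rparr> p"
proof -
  have "successively (\<lambda>u v. {u, v} \<in> F') p"
    by (rule successively_mono[of "\<lambda>u v. {u, v} \<in> F"]) (use assms in \<open>auto simp: walk_def\<close>)
  then show ?thesis using assms by (auto simp: walk_def)
qed

lemma tree_add_leaf:
  assumes tree: "tree \<lparr>verts = W, edges = F\<rparr>" and t: "t \<notin> W" and s: "s \<in> W"
  shows "tree \<lparr>verts = insert t W, edges = insert {s, t} F\<rparr>"
proof -
  let ?H = "\<lparr>verts = insert t W, edges = insert {s, t} F\<rparr>"
  have F: "\<forall>e \<in> F. e \<subseteq> W" using tree by (auto simp: tree_def ugraph_def)
  have "s \<noteq> t" using t s by auto
  then have "ugraph ?H" using tree t s by (auto simp: tree_def ugraph_def)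
  moreover have "\<nexists>p. cycle ?H p"
    using cycle_add_leaf[OF t s F] tree by (auto simp: tree_def)
  moreover have "connected_graph ?H"
  proof -
    have conn: "\<exists>p. walk ?H p \<and> hd p = u \<and> last p = v" if "u \<in> W" "v \<in> W" for u v
    proof -
      have "\<exists>p. walk \<lparr>verts = W, edges = F\<rparr> p \<and> hd p = u \<and> last p = v"
        using that tree by (simp add: tree_def connected_graph_def)
      then obtain p where "walk \<lparr>verts = W, edges = F\<rparr> p" "hd p = u" "last p = v" by blast
      then show ?thesis using walk_mono[of W F p "insert t W" "insert {s, t} F"] by auto
    qed
    have "\<exists>p. walk ?H p \<and> hd p = u \<and> last p = v"
      if uv: "u \<in> insert t W" "v \<in> insert t W" for u v
    proof -
      consider "u = t" "v = t" | "u = t" "v \<in> W" | "u \<in> W" "v = t" | "u \<in> W" "v \<in> W"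
        using uv by auto
      then show ?thesis
      proof cases
        case 1
        then show ?thesis by (intro exI[of _ "[t]"]) (auto simp: walk_def)
      next
        case 2
        obtain p where "walk ?H p" "hd p = s" "last p = v" using conn[OF s 2(2)] by blast
        then show ?thesis using 2
          by (intro exI[of _ "t # p"]) (auto simp: walk_def successively_Cons insert_commute)
      next
        case 3
        obtain p where "walk ?H p" "hd p = u" "last p = s" using conn[OF 3(1) s] by blast
        then show ?thesis using 3
          by (intro exI[of _ "p @ [t]"]) (auto simp: walk_def successively_append_iff)
      next
        case 4
        then show ?thesis using conn by blast
      qed
    qed
    then show ?thesis by (auto simp: connected_graph_def)
  qed
  ultimately show ?thesis by (simp add: tree_def)
qed

lemma tree_add_leaves:
  assumes "tree \<lparr>verts = W, edges = F\<rparr>" "finite X" "X \<inter> W = {}" "\<forall>t \<in> X. f t \<in> W"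
  shows "tree \<lparr>verts = W \<union> X, edges = F \<union> (\<lambda>t. {f t, t}) ` X\<rparr>"
  using assms(2-)
proof (induction X rule: finite_induct)
  case empty
  then show ?case using assms(1) by simp
next
  case (insert t X)
  then have "tree \<lparr>verts = insert t (W \<union> X), edges = insert {f t, t} (F \<union> (\<lambda>t. {f t, t}) ` X)\<rparr>"
    by (intro tree_add_leaf) auto
  then show ?case by simp
qed

section \<open>Passing between solutions of the two problems\<close>

lemma connected_vertex_in_edge:
  assumes "connected_graph G" "x \<in> verts G" "y \<in> verts G" "x \<noteq> y"
  obtains e where "e \<in> edges G" "x \<in> e"
proof -
  obtain p where p: "walk G p" "hd p = x" "last p = y"
    using assms by (auto simp: connected_graph_def)
  obtain q where "p = x # q" using p by (cases p) (auto simp: walk_def)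
  moreover have "q \<noteq> []" using calculation p assms(4) by auto
  ultimately have "{x, hd q} \<in> edges G" using p by (auto simp: walk_def successively_Cons)
  then show ?thesis by (rule that) simp
qed

text \<open>A dominating set solution names only \<open>F\<close> and \<open>S\<close>, while
  \<open>spans_tree\<close> leaves the vertex set existential. They determine it: by connectedness
  every vertex different from a chosen \<open>s\<close> in \<open>S\<close> lies on an edge. With
  \<open>S\<close> and \<open>F\<close> both empty it would be lost.\<close>

lemma spans_tree_verts:
  assumes "spans_tree G F S" "S \<noteq> {}"
  shows "tree \<lparr>verts = S \<union> \<Union>F, edges = F\<rparr>"
proof -
  obtain W where W: "tree \<lparr>verts = W, edges = F\<rparr>" "S \<subseteq> W"
    using assms by (auto simp: spans_tree_def)
  have "\<Union>F \<subseteq> W" using W by (auto simp: tree_def ugraph_def)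
  moreover have "W \<subseteq> S \<union> \<Union>F"
  proof
    fix x assume x: "x \<in> W"
    obtain s where s: "s \<in> S" using assms by auto
    show "x \<in> S \<union> \<Union>F"
    proof (cases "x = s")
      case False
      then obtain e where "e \<in> F" "x \<in> e"
        using connected_vertex_in_edge[of "\<lparr>verts = W, edges = F\<rparr>" x s] W x s
        by (auto simp: tree_def)
      then show ?thesis by auto
    qed (use s in simp)
  qed
  ultimately have "W = S \<union> \<Union>F" using W(2) by auto
  then show ?thesis using W(1) by simp
qed

text \<open>\<open>c\<close> chooses an end of each edge whose weight is the length, and
  \<open>f\<close> a neighbour in \<open>S\<close> for each missed terminal. Attaching these
  terminals is free: the new edges are covered by \<open>S\<close>, whose weight is paid
  already.\<close>

lemma vcst_of_cds:
  assumes G: "ugraph G" and w: "\<forall>v \<in> verts G. 0 \<le> w v" and T: "T \<subseteq> verts G"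
    and feas: "cds_feasible (G, w, l, T) (F, S)" and "S \<noteq> {}"
    and c: "\<forall>e \<in> F. c e \<in> e \<and> w (c e) = l e"
    and f: "\<forall>t \<in> T - (S \<union> \<Union>F). f t \<in> S \<and> {f t, t} \<in> edges G"
  shows "vcst_feasible (G, w, T)
      (\<lparr>verts = S \<union> \<Union>F \<union> T, edges = F \<union> (\<lambda>t. {f t, t}) ` (T - (S \<union> \<Union>F))\<rparr>, S \<union> c ` F)" (is ?A)
    and "sum w (S \<union> c ` F) \<le> cds_objective (G, w, l, T) (F, S)" (is ?B)
proof -
  let ?X = "T - (S \<union> \<Union>F)"
  have fin: "finite (verts G)" using G by (simp add: ugraph_def)
  have F: "F \<subseteq> edges G" "S \<subseteq> verts G" "spans_tree G F S" using feas by auto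
  have eG: "e \<subseteq> verts G" if "e \<in> edges G" for e using G that by (auto simp: ugraph_def)
  have "finite (edges G)" by (rule finite_subset[of _ "Pow (verts G)"]) (use eG fin in auto)
  then have finF: "finite F" using F(1) finite_subset by blast
  have finS: "finite S" using F(2) fin finite_subset by blast
  have "finite ?X" using T fin finite_subset by blast
  then have "tree \<lparr>verts = S \<union> \<Union>F \<union> ?X, edges = F \<union> (\<lambda>t. {f t, t}) ` ?X\<rparr>"
    by (rule tree_add_leaves[OF spans_tree_verts[OF F(3) assms(5)]]) (use f in auto)
  moreover have "S \<union> \<Union>F \<union> ?X = S \<union> \<Union>F \<union> T" by auto
  ultimately show ?A
    using F eG f c T by (auto simp: subgraph_def vertex_cover_def)
  have wpos: "0 \<le> w (c e)" if "e \<in> F" for e using that c w eG F(1) by blast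
  \<comment> \<open>This drops the nonnegative weight of the overlap; the next inequality allows for
    several edges with the same chosen end.\<close>
  have "sum w (S \<union> c ` F) \<le> sum w S + sum w (c ` F)"
    using sum.union_inter[of S "c ` F" w] finS finF sum_nonneg[of "S \<inter> c ` F" w] F(2) w
    by fastforce
  also have "sum w (c ` F) \<le> sum (w \<circ> c) F"
    by (rule sum_image_le[OF finF]) (use wpos in auto)
  also have "sum (w \<circ> c) F = sum l F" using c by (intro sum.cong) auto
  finally show ?B by simp
qed

text \<open>Two terminals force every terminal onto an edge of the connected tree, and that edge
  meets \<open>U\<close> in the terminal or in its other end. With a single terminal the tree may be
  one vertex with empty cover, which does not dominate it.\<close>

lemma cds_of_vcst:
  assumes feas: "vcst_feasible (G, w, T) (F, U)" and "x \<in> T" "y \<in> T" "x \<noteq> y"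
  shows "cds_feasible (G, w, l, T) (edges F, U)"
proof -
  have F: "tree F" "subgraph F G" "T \<subseteq> verts F" "vertex_cover F U" using feas by auto
  have "dominates G U T"
    unfolding dominates_def
  proof
    fix t assume t: "t \<in> T"
    obtain z where "z \<in> T" "z \<noteq> t" using assms by metis
    then obtain e where e: "e \<in> edges F" "t \<in> e"
      using connected_vertex_in_edge[of F t z] F t by (auto simp: tree_def)
    obtain u where u: "u \<in> e" "u \<in> U" using F(4) e by (auto simp: vertex_cover_def)
    have "card e = 2" using F(1) e by (auto simp: tree_def ugraph_def)
    then have "t = u \<or> e = {u, t}" using e u by (auto simp: card_2_iff)
    then show "t \<in> U \<or> (\<exists>s\<in>U. {s, t} \<in> edges G)"
      using u e F(2) by (auto simp: subgraph_def)
  qed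
  moreover have F_eq: "\<lparr>verts = verts F, edges = edges F\<rparr> = F" by simp
  have "spans_tree G (edges F) U"
    unfolding spans_tree_def
    by (rule exI[of _ "verts F"], unfold F_eq) (use F in \<open>simp add: vertex_cover_def\<close>)
  ultimately show ?thesis using F by (auto simp: subgraph_def vertex_cover_def)
qed

text \<open>Double counting of incidences: charge each edge to all cover vertices on it, then
  exchange the sums. An edge with both ends in \<open>U\<close> is charged twice, which is harmless
  because the weights on \<open>U\<close> are nonnegative.\<close>

lemma sum_edges_le_degree:
  assumes fin: "finite F" "finite U" and U: "\<forall>e \<in> F. e \<inter> U \<noteq> {}"
    and l: "\<forall>e \<in> F. \<forall>v \<in> e. l e \<le> w v" and w: "\<forall>u \<in> U. 0 \<le> (w u :: real)"
  shows "sum l F \<le> (\<Sum>u\<in>U. real (card {e \<in> F. u \<in> e}) * w u)"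
proof -
  have "sum l F \<le> (\<Sum>e\<in>F. \<Sum>u | u \<in> U \<and> u \<in> e. w u)"
  proof (rule sum_mono)
    fix e assume e: "e \<in> F"
    obtain u where u: "u \<in> e" "u \<in> U" using U e by auto
    have "l e \<le> w u" using l e u by auto
    also have "\<dots> \<le> (\<Sum>u | u \<in> U \<and> u \<in> e. w u)"
      by (rule member_le_sum) (use u w fin in auto)
    finally show "l e \<le> (\<Sum>u | u \<in> U \<and> u \<in> e. w u)" .
  qed
  also have "\<dots> = (\<Sum>u\<in>U. \<Sum>e | e \<in> F \<and> u \<in> e. w u)"
    by (rule sum.swap_restrict[OF fin])
  finally show ?thesis by simp
qed

lemma cds_objective_le:
  assumes G: "ugraph G" and w: "\<forall>v \<in> verts G. 0 \<le> w v"
    and feas: "vcst_feasible (G, w, T) (F, U)"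
    and l: "\<forall>e \<in> edges G. \<forall>v \<in> e. l e \<le> w v"
    and deg: "\<forall>u \<in> U. real (degree_in F u) \<le> a"
  shows "cds_objective (G, w, l, T) (edges F, U) \<le> (a + 1) * vcst_objective (G, w, T) (F, U)"
proof -
  have F: "tree F" "subgraph F G" "vertex_cover F U" using feas by auto
  have fin: "finite (verts F)" "finite (edges F)" using F(1)
    by (auto simp: tree_def ugraph_def intro: finite_subset[of _ "Pow (verts F)"])
  have U: "U \<subseteq> verts F" "\<forall>u \<in> U. 0 \<le> w u" using F w by (auto simp: vertex_cover_def subgraph_def)
  have "sum l (edges F) \<le> (\<Sum>u\<in>U. real (degree_in F u) * w u)"
    unfolding degree_in_def
    by (rule sum_edges_le_degree)
      (use F U fin l in \<open>auto simp: vertex_cover_def subgraph_def intro: finite_subset\<close>)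
  also have "\<dots> \<le> (\<Sum>u\<in>U. a * w u)"
    by (rule sum_mono, rule mult_right_mono) (use deg U in auto)
  finally show ?thesis by (simp add: sum_distrib_left[symmetric] distrib_right)
qed

text \<open>The approximation guarantee compares with optimal solutions only and would be void
  without one. One exists because there are only finitely many edge sets and vertex sets.\<close>

lemma cds_optimal_exists:
  assumes "ugraph G" "cds_feasible (G, w, l, T) s"
  obtains s' where "optimal cds (G, w, l, T) s'"
proof -
  let ?A = "{s. cds_feasible (G, w, l, T) s}"
  have "finite (verts G)" "edges G \<subseteq> Pow (verts G)" using assms(1) by (auto simp: ugraph_def)
  then have "finite (edges G)" using finite_subset by blast
  moreover have "?A \<subseteq> Pow (edges G) \<times> Pow (verts G)" by auto
  ultimately have "finite ?A" using \<open>finite (verts G)\<close> finite_subset by blast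
  from ex_is_arg_min_if_finite[OF this, of "cds_objective (G, w, l, T)"] assms(2)
  obtain s' where "is_arg_min (cds_objective (G, w, l, T)) (\<lambda>s. s \<in> ?A) s'" by blast
  then have "optimal cds (G, w, l, T) s'"
    by (auto simp: is_arg_min_linorder optimal_def cds_def simp del: cds_feasible.simps cds_objective.simps)
  then show ?thesis by (rule that)
qed

section \<open>Translation programs\<close>

text \<open>Closure under list operations is stated for functions of a pair of context and element.
  A binary function is therefore treated on the two projections once, and arbitrary arguments are
  substituted afterwards.\<close>

lemma polytime_comp2:
  assumes "polytime M (\<lambda>p. h (the_fst p) (the_snd p))" "polytime M f" "polytime M g"
  shows "polytime M (\<lambda>v. h (f v) (g v))"
  using polytime_comp[OF polytime_pair[OF assms(2,3)] assms(1)] by simp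

text \<open>The only comparison of numbers in the language is \<open>Less\<close>, so equality of
  vertex numbers is expressed through it.\<close>

definition same_val :: "val \<Rightarrow> val \<Rightarrow> bool" where
  "same_val x y \<longleftrightarrow> \<not> the_num x < the_num y \<and> \<not> the_num y < the_num x"

text \<open>\<open>vs\<close> is the weighted vertex list of an instance. Filtering instead of a
  recursive search makes polynomial time a consequence of the closure properties.\<close>

definition weight_val :: "val \<Rightarrow> val \<Rightarrow> val" where
  "weight_val vs u = the_snd (the_fst (enc_list (filter (\<lambda>q. same_val (the_fst q) u) (the_list vs))))"

definition cheaper_val :: "val \<Rightarrow> val \<Rightarrow> val" where
  "cheaper_val vs e =
     (if the_num (weight_val vs (the_fst e)) < the_num (weight_val vs (the_snd e)) \<or>
         \<not> the_num (weight_val vs (the_snd e)) < the_num (weight_val vs (the_fst e)) \<and>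
         the_num (the_fst e) < the_num (the_snd e)
      then the_fst e else the_snd e)"

definition edge_weight_val :: "val \<Rightarrow> val \<Rightarrow> val" where
  "edge_weight_val vs e = VPair e (weight_val vs (cheaper_val vs e))"

definition member_val :: "val \<Rightarrow> val \<Rightarrow> bool" where
  "member_val u l \<longleftrightarrow> (\<exists>z \<in> set (the_list l). same_val z u)"

definition to_cds_val :: "val \<Rightarrow> val" where
  "to_cds_val x = VPair (the_fst x) (VPair
     (enc_list (map (edge_weight_val (the_fst x)) (the_list (the_fst (the_snd x)))))
     (the_snd (the_snd x)))"

text \<open>By \<open>spans_tree_verts\<close> the tree of a solution has vertex set
  \<open>S \<union> \<Union>F\<close> if \<open>S\<close> is nonempty. Vertices may recur in this
  list, which \<open>encodes_verts\<close> permits.\<close>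

definition tree_verts_val :: "val \<Rightarrow> val" where
  "tree_verts_val y = enc_list (the_list (the_fst (the_snd y)) @ the_list (enc_list
     (concat (map (\<lambda>e. the_list (VPair (the_fst e) (VPair (the_snd e) VNil)))
       (the_list (the_fst y))))))"

text \<open>In \<open>attach_val\<close> and \<open>of_cds_val\<close>, \<open>xy\<close> pairs a Steiner tree instance with a solution of the
  dominating set instance derived from it.\<close>

definition attach_val :: "val \<Rightarrow> val \<Rightarrow> val" where
  "attach_val xy t = the_fst (enc_list (filter
     (\<lambda>e. same_val (the_fst e) t \<and> member_val (the_snd e) (the_fst (the_snd (the_snd xy))) \<or>
          same_val (the_snd e) t \<and> member_val (the_fst e) (the_fst (the_snd (the_snd xy))))
     (the_list (the_fst (the_snd (the_fst xy))))))"

definition of_cds_val :: "val \<Rightarrow> val" where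
  "of_cds_val xy = VPair
     (enc_list (the_list (tree_verts_val (the_snd xy)) @
        the_list (the_fst (the_snd (the_snd (the_fst xy))))))
     (VPair (enc_list (the_list (the_fst (the_snd xy)) @ the_list (enc_list (map (attach_val xy)
        (the_list (enc_list (filter (\<lambda>t. \<not> member_val t (tree_verts_val (the_snd xy)))
          (the_list (the_fst (the_snd (the_snd (the_fst xy))))))))))))
     (VPair (enc_list (the_list (the_fst (the_snd (the_snd xy))) @ the_list (enc_list (map
        (\<lambda>e. cheaper_val (the_fst (the_fst xy)) e) (the_list (the_fst (the_snd xy)))))))
     VNil))"

text \<open>Meant for at most one terminal: a nonempty terminal list then is itself the vertex list
  of the tree, and otherwise the first listed vertex is taken. The edge set and the cover are
  empty.\<close>

definition single_vertex_val :: "val \<Rightarrow> val" where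
  "single_vertex_val x = VPair (if is_pair (the_fst (the_snd (the_snd x)))
     then the_fst (the_snd (the_snd x)) else VPair (the_fst (the_fst (the_fst x))) VNil)
     (VPair VNil (VPair VNil VNil))"

lemma polytest_same_val:
  assumes "polytime M f" "polytime M g"
  shows "polytest M (\<lambda>v. same_val (f v) (g v))"
  unfolding same_val_def by (intro polytest_conj polytest_not polytest_less assms)

lemmas polytime_basic = polytime_fst polytime_snd polytime_pair polytime_nil polytime_id
  polytime_if polytest_not polytest_conj polytest_disj polytest_less polytest_same_val polytest_pair

lemma polytime_weight_val:
  assumes "polytime M f" "polytime M g"
  shows "polytime M (\<lambda>v. weight_val (f v) (g v))"
  by (rule polytime_comp2[OF _ assms], unfold weight_val_def)
    (intro polytime_filter polytime_basic)

lemma polytime_cheaper_val: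
  assumes "polytime M f" "polytime M g"
  shows "polytime M (\<lambda>v. cheaper_val (f v) (g v))"
  unfolding cheaper_val_def by (intro polytime_weight_val polytime_basic assms)

lemma polytime_edge_weight_val:
  assumes "polytime M f" "polytime M g"
  shows "polytime M (\<lambda>v. edge_weight_val (f v) (g v))"
  unfolding edge_weight_val_def
  by (intro polytime_weight_val polytime_cheaper_val polytime_basic assms)

lemma polytest_member_val:
  assumes "polytime M f" "polytime M g"
  shows "polytest M (\<lambda>v. member_val (f v) (g v))"
proof -
  have "polytest M (\<lambda>p. member_val (the_fst p) (the_snd p))"
    unfolding member_val_def by (intro polytest_bex polytime_basic)
  then have "polytime M (\<lambda>p. of_bool_val (member_val (the_fst p) (the_snd p)))"
    by (simp add: polytest_def)
  from polytime_comp2[of M "\<lambda>x y. of_bool_val (member_val x y)", OF this assms]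
  show ?thesis by (simp add: polytest_def)
qed

lemma polytime_to_cds_val: "polytime M to_cds_val"
  unfolding to_cds_val_def[abs_def]
  by (intro polytime_map polytime_edge_weight_val polytime_basic)

lemma polytime_tree_verts_val:
  assumes "polytime M f"
  shows "polytime M (\<lambda>v. tree_verts_val (f v))"
  unfolding tree_verts_val_def
  by (intro polytime_append polytime_flatmap polytime_basic polytime_comp[OF _ assms] assms)

lemma polytime_attach_val:
  assumes "polytime M f" "polytime M g"
  shows "polytime M (\<lambda>v. attach_val (f v) (g v))"
  by (rule polytime_comp2[OF _ assms], unfold attach_val_def)
    (intro polytime_filter polytest_member_val polytime_basic)

lemma polytime_of_cds_val: "polytime M of_cds_val"
  unfolding of_cds_val_def[abs_def]
  by (intro polytime_append polytime_map polytime_filter polytime_tree_verts_val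
      polytime_attach_val polytime_cheaper_val polytest_member_val polytime_basic)

lemma polytime_single_vertex_val: "polytime M single_vertex_val"
  unfolding single_vertex_val_def[abs_def] by (intro polytime_basic)

text \<open>The third component of an encoded instance is the terminal list; its tail is a pair
  exactly if the list has at least two entries.\<close>

lemma polytest_two_terminals: "polytest M (\<lambda>x. is_pair (the_snd (the_fst (the_snd (the_snd x)))))"
  by (intro polytime_basic)

text \<open>The program saves the input, tests it, and then either answers by \<open>triv\<close> or
  runs \<open>red\<close>, the algorithm \<open>A\<close>, and \<open>post\<close> on the saved
  input paired with the output of \<open>A\<close>. The time bound on \<open>A\<close> is assumed
  run by run, because it is known only for encodings of instances; \<open>B\<close> and
  \<open>p\<close> nevertheless do not depend on \<open>x\<close>.\<close>

lemma polytime_reduction: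
  assumes red: "polytime M red" and post: "polytime M post" and triv: "polytime M triv"
    and hard: "polytest M hard"
  shows "\<exists>B p. \<forall>x. (\<not> hard x \<longrightarrow> (\<exists>t. computes M B x t (triv x) \<and> t \<le> poly p (val_size M x))) \<and>
    (\<forall>t y. hard x \<longrightarrow> computes M A (red x) t y \<longrightarrow> t \<le> poly pA (val_size M (red x)) \<longrightarrow>
      (\<exists>t'. computes M B x t' (post (VPair x y)) \<and> t' \<le> poly p (val_size M x)))"
proof -
  \<comment> \<open>Variables \<open>k\<close> and \<open>Suc k\<close> lie beyond those of
    \<open>A\<close> and will hold the saved input and the test result; \<open>0 < k\<close> keeps
    them apart from the input and output variable 0.\<close>
  obtain k where k: "com_vars A \<subseteq> {..<k}" "0 < k"
  proof -
    obtain m where "\<forall>x \<in> com_vars A. x < m"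
      using finite_com_vars[of A] by (meson finite_nat_set_iff_bounded)
    then show ?thesis by (intro that[of "Suc m"]) (auto intro: less_SucI)
  qed
  obtain qr where qr: "\<And>v. val_size M (red v) \<le> poly qr (val_size M v)"
    using polytime_val_size[OF red] by blast
  \<comment> \<open>All auxiliary commands are taken for \<open>k+2\<close> variables, so their own
    work happens beyond the saved data, and the work variables of \<open>A\<close> are still
    \<open>VNil\<close> when \<open>A\<close> starts.\<close>
  obtain ch ph where ch: "\<And>s. \<exists>t s'. exec M ch s t s' \<and> t \<le> poly ph (val_size M (s k)) \<and>
      s' (Suc k) = of_bool_val (hard (s k)) \<and> (\<forall>z<k+2. z \<noteq> Suc k \<longrightarrow> s' z = s z)"
    by (rule polytimeE[OF hard[unfolded polytest_def], of k "k+2" "Suc k"]) auto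
  obtain ct pt where ct: "\<And>s. \<exists>t s'. exec M ct s t s' \<and> t \<le> poly pt (val_size M (s k)) \<and>
      s' 0 = triv (s k) \<and> (\<forall>z<k+2. z \<noteq> 0 \<longrightarrow> s' z = s z)"
    by (rule polytimeE[OF triv, of k "k+2" 0]) auto
  obtain cr pr where cr: "\<And>s. \<exists>t s'. exec M cr s t s' \<and> t \<le> poly pr (val_size M (s k)) \<and>
      s' 0 = red (s k) \<and> (\<forall>z<k+2. z \<noteq> 0 \<longrightarrow> s' z = s z)"
    by (rule polytimeE[OF red, of k "k+2" 0]) auto
  obtain cp pp where cp: "\<And>s. \<exists>t s'. exec M cp s t s' \<and> t \<le> poly pp (val_size M (s (Suc k))) \<and>
      s' 0 = post (s (Suc k)) \<and> (\<forall>z<k+2. z \<noteq> 0 \<longrightarrow> s' z = s z)"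
    by (rule polytimeE[OF post, of "Suc k" "k+2" 0]) auto
  let ?hard_branch = "Seq cr (Seq A (Seq (Assign (Suc k) (Cons (Var k) (Var 0))) cp))"
  let ?B = "Seq (Assign k (Var 0)) (Seq ch (If (Is_Pair (Var (Suc k))) ?hard_branch ct))"
  define X :: "nat poly" where "X = [:0, 1:]"
  \<comment> \<open>\<open>TA\<close> bounds the time of \<open>A\<close> on the translated input
    and \<open>Y\<close> the size of the pair handed to \<open>post\<close>, both in the size of the
    original input: the output of \<open>A\<close> is at most as large as its input plus its
    time.\<close>
  define TA where "TA = pcompose pA qr"
  define Y where "Y = X + qr + TA + 1"
  define p where "p = 10 + 10 * X + ph + pt + pr + TA + 10 * Y + pcompose pp Y"
  have start: "\<exists>t s. exec M (Seq (Assign k (Var 0)) ch) ((\<lambda>_. VNil)(0 := x)) t s \<and>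
      t \<le> 1 + val_size M x + poly ph (val_size M x) \<and> s (Suc k) = of_bool_val (hard x) \<and>
      s k = x \<and> (\<forall>z<k. z \<noteq> 0 \<longrightarrow> s z = VNil)" for x
  proof -
    let ?s0 = "(\<lambda>_. VNil)(0 := x)" and ?s1 = "(\<lambda>_. VNil)(0 := x, k := x)"
    have 1: "exec M (Assign k (Var 0)) ?s0 (1 + val_size M x) ?s1"
      using exec.Assign[of M k "Var 0" ?s0] by simp
    obtain t2 s2 where 2: "exec M ch ?s1 t2 s2" "t2 \<le> poly ph (val_size M (?s1 k))"
      "s2 (Suc k) = of_bool_val (hard (?s1 k))" "\<forall>z<k+2. z \<noteq> Suc k \<longrightarrow> s2 z = ?s1 z"
      using ch by blast
    from exec.Seq[OF 1 2(1)] show ?thesis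
      by (intro exI[of _ "1 + val_size M x + t2"] exI[of _ s2]) (use 2 in auto)
  qed
  \<comment> \<open>\<open>start\<close> groups the first two commands, whereas \<open>?B\<close>
    nests to the right; regrouping does not change the time.\<close>
  have reassoc: "exec M ?B s (t + t') s''"
    if "exec M (Seq (Assign k (Var 0)) ch) s t s'"
      "exec M (If (Is_Pair (Var (Suc k))) ?hard_branch ct) s' t' s''" for s t s' t' s''
    using that(1)
  proof (cases rule: exec.cases)
    case (Seq t1 s1 t2)
    then show ?thesis using exec.Seq[OF Seq(2) exec.Seq[OF Seq(3) that(2)]]
      by (simp add: add.assoc)
  qed
  have easy_case: "\<exists>t. computes M ?B x t (triv x) \<and> t \<le> poly p (val_size M x)" if "\<not> hard x" for x
  proof -
    obtain t1 s1 where 1: "exec M (Seq (Assign k (Var 0)) ch) ((\<lambda>_. VNil)(0 := x)) t1 s1"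
      "t1 \<le> 1 + val_size M x + poly ph (val_size M x)" "s1 (Suc k) = of_bool_val (hard x)"
      "s1 k = x" using start by blast
    obtain t2 s2 where 2: "exec M ct s1 t2 s2" "t2 \<le> poly pt (val_size M (s1 k))"
      "s2 0 = triv (s1 k)" using ct by blast
    have "exec M (If (Is_Pair (Var (Suc k))) ?hard_branch ct) s1
        (test_cost M (Is_Pair (Var (Suc k))) s1 + t2) s2"
      by (rule exec.If_False[OF _ 2(1)]) (use 1 that in \<open>simp add: of_bool_val_def\<close>)
    from reassoc[OF 1(1) this] have "computes M ?B x (t1 + (test_cost M (Is_Pair (Var (Suc k))) s1 + t2))
        (triv x)"
      using 2(3) 1(4) unfolding computes_def by auto
    moreover have "t1 + (test_cost M (Is_Pair (Var (Suc k))) s1 + t2) \<le> poly p (val_size M x)"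
      using 1 2(2) that by (simp add: of_bool_val_def p_def X_def)
    ultimately show ?thesis by blast
  qed
  have hard_case: "\<exists>t'. computes M ?B x t' (post (VPair x y)) \<and> t' \<le> poly p (val_size M x)"
    if h: "hard x" and A: "computes M A (red x) t y" and t: "t \<le> poly pA (val_size M (red x))"
    for x t y
  proof -
    let ?n = "val_size M x"
    obtain t1 s1 where 1: "exec M (Seq (Assign k (Var 0)) ch) ((\<lambda>_. VNil)(0 := x)) t1 s1"
      "t1 \<le> 1 + ?n + poly ph ?n" "s1 (Suc k) = of_bool_val (hard x)"
      "s1 k = x" "\<forall>z<k. z \<noteq> 0 \<longrightarrow> s1 z = VNil" using start by blast
    obtain t2 s2 where 2: "exec M cr s1 t2 s2" "t2 \<le> poly pr (val_size M (s1 k))"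
      "s2 0 = red (s1 k)" "\<forall>z<k+2. z \<noteq> 0 \<longrightarrow> s2 z = s1 z" using cr by blast
    obtain s where s: "exec M A ((\<lambda>_. VNil)(0 := red x)) t s" "s 0 = y"
      using A unfolding computes_def by blast
    \<comment> \<open>Below \<open>k\<close> the current state is the standard start state of
      \<open>A\<close>, so \<open>exec_frame\<close> applies to the given run.\<close>
    have "\<forall>z \<in> {..<k}. ((\<lambda>_. VNil)(0 := red x)) z = s2 z" using 1 2 by auto
    from exec_frame[OF s(1) k(1) this] obtain s3 where 3: "exec M A s2 t s3"
      "\<forall>z \<in> {..<k}. s3 z = s z" "\<forall>z. z \<notin> {..<k} \<longrightarrow> s3 z = s2 z" by blast
    have s3: "s3 0 = y" "s3 k = x" using 3 s k 2 1 by auto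
    let ?e = "Cons (Var k) (Var 0)" and ?s4 = "s3(Suc k := VPair x y)"
    have 4: "exec M (Assign (Suc k) ?e) s3 (1 + exp_cost M ?e s3) ?s4"
      using exec.Assign[of M "Suc k" ?e s3] s3 by simp
    obtain t5 s5 where 5: "exec M cp ?s4 t5 s5" "t5 \<le> poly pp (val_size M (?s4 (Suc k)))"
      "s5 0 = post (?s4 (Suc k))" using cp by blast
    let ?t = "test_cost M (Is_Pair (Var (Suc k))) s1 + (t2 + (t + (1 + exp_cost M ?e s3 + t5)))"
    have "exec M (If (Is_Pair (Var (Suc k))) ?hard_branch ct) s1 ?t s5"
      by (rule exec.If_True[OF _ exec.Seq[OF 2(1) exec.Seq[OF 3(1) exec.Seq[OF 4 5(1)]]]])
        (use 1 h in \<open>simp add: of_bool_val_def\<close>)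
    from reassoc[OF 1(1) this] have "computes M ?B x (t1 + ?t) (post (VPair x y))"
      using 5(3) unfolding computes_def by auto
    moreover have "t1 + ?t \<le> poly p ?n"
    proof -
      have tA: "t \<le> poly TA ?n"
        using t poly_nat_mono[OF qr, of pA x] by (simp add: TA_def poly_pcompose)
      have "val_size M y \<le> val_size M (red x) + t" using exec_val_size[OF s(1), of 0] s(2) by simp
      then have Y: "val_size M (VPair x y) \<le> poly Y ?n"
        using qr[of x] tA by (simp add: Y_def X_def)
      have "t5 \<le> poly pp (poly Y ?n)" using 5(2) poly_nat_mono[OF Y, of pp] by simp
      moreover have "exp_cost M ?e s3 \<le> 2 * poly Y ?n" using Y s3 by simp
      moreover have "t2 \<le> poly pr ?n" using 2(2) 1(4) by simp
      moreover have "test_cost M (Is_Pair (Var (Suc k))) s1 = 4"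
        using 1(3) h by (simp add: of_bool_val_def)
      moreover have "poly p ?n = 10 + 10 * ?n + poly ph ?n + poly pt ?n + poly pr ?n +
          poly TA ?n + 10 * poly Y ?n + poly pp (poly Y ?n)"
        by (simp add: p_def X_def poly_pcompose)
      ultimately show ?thesis using 1(2) tA by linarith
    qed
    ultimately show ?thesis by blast
  qed
  show ?thesis
    by (rule exI[of _ ?B], rule exI[of _ p]) (use easy_case hard_case in blast)
qed

section \<open>Correctness of the translations\<close>

text \<open>Ties are broken by the vertex numbers, so that the choice is a function of the edge rather than
  of the order in which a list happens to give its ends.\<close>

fun cheaper :: "(nat \<Rightarrow> real) \<Rightarrow> nat \<times> nat \<Rightarrow> nat" where
  "cheaper w (u, v) = (if w u < w v \<or> \<not> w v < w u \<and> u < v then u else v)"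

lemma ends_conv: "ends e = {fst e, snd e}"
  by (cases e) auto

lemma cheaper_ends: "ends e = ends e' \<Longrightarrow> cheaper w e = cheaper w e'"
  by (cases e; cases e') (auto simp: doubleton_eq_iff)

lemma cheaper_in_ends: "cheaper w e \<in> ends e"
  by (cases e) auto

text \<open>\<open>Min\<close> expresses the length through the edge as a set, independently of the
  order of its listed ends.\<close>

lemma weight_cheaper: "w (cheaper w e) = Min (w ` ends e)"
  by (cases e) (auto simp: min_def)

abbreviation enc_weights :: "(nat \<Rightarrow> real) \<Rightarrow> nat list \<Rightarrow> val" where
  "enc_weights w vs \<equiv> enc_list (map (\<lambda>v. VPair (enc_vertex v) (VNum (w v))) vs)"

lemma the_fst_enc_list [simp]: "xs \<noteq> [] \<Longrightarrow> the_fst (enc_list xs) = hd xs"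
  by (cases xs) auto

lemma the_num_enc_vertex [simp]: "the_num (enc_vertex v) = real v"
  by (simp add: enc_vertex_def)

lemma same_val_enc_vertex [simp]: "same_val (enc_vertex u) (enc_vertex v) \<longleftrightarrow> u = v"
  by (auto simp: same_val_def)

lemma enc_edge_conv: "enc_edge e = VPair (enc_vertex (fst e)) (enc_vertex (snd e))"
  by (cases e) auto

lemma member_val_enc [simp]:
  "member_val (enc_vertex u) (enc_list (map enc_vertex us)) \<longleftrightarrow> u \<in> set us"
  by (auto simp: member_val_def)

lemma weight_val_enc [simp]:
  assumes "v \<in> set vs"
  shows "weight_val (enc_weights w vs) (enc_vertex v) = VNum (w v)"
proof -
  let ?xs = "filter (\<lambda>u. u = v) vs"
  have "?xs \<noteq> []" using assms by (auto simp: filter_empty_conv)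
  then have "hd ?xs = v" using hd_in_set[of ?xs] by auto
  then show ?thesis using \<open>?xs \<noteq> []\<close>
    by (simp add: weight_val_def filter_map comp_def hd_map)
qed

lemma cheaper_val_enc [simp]:
  assumes "ends e \<subseteq> set vs"
  shows "cheaper_val (enc_weights w vs) (enc_edge e) = enc_vertex (cheaper w e)"
  using assms by (cases e) (simp add: cheaper_val_def)

lemma to_cds_val_enc:
  assumes "\<forall>e \<in> set es. ends e \<subseteq> set vs"
  shows "to_cds_val (enc_list [enc_weights w vs, enc_list (map enc_edge es), enc_list ts]) =
    enc_list [enc_weights w vs,
      enc_list (map (\<lambda>e. VPair (enc_edge e) (VNum (Min (w ` ends e)))) es), enc_list ts]"
proof -
  have "edge_weight_val (enc_weights w vs) (enc_edge e) = VPair (enc_edge e) (VNum (Min (w ` ends e)))"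
    if "e \<in> set es" for e
  proof -
    have "cheaper w e \<in> set vs" using cheaper_in_ends[of w e] assms that by blast
    then show ?thesis using assms that
      by (simp add: edge_weight_val_def weight_cheaper[symmetric] del: enc_edge.simps)
  qed
  then show ?thesis by (simp add: to_cds_val_def comp_def cong: map_cong)
qed

text \<open>\<open>hd\<close> is meaningful only if \<open>t\<close> has a neighbour in
  \<open>sl\<close>; \<open>attach_candidates\<close> shows that the filtered list is nonempty
  then.\<close>

definition attach :: "(nat \<times> nat) list \<Rightarrow> nat list \<Rightarrow> nat \<Rightarrow> nat \<times> nat" where
  "attach es sl t = hd (filter
     (\<lambda>e. fst e = t \<and> snd e \<in> set sl \<or> snd e = t \<and> fst e \<in> set sl) es)"

lemma attach_candidates:
  assumes "ends ` set es = edges G" "s \<in> set sl" "{s, t} \<in> edges G"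
  shows "filter (\<lambda>e. fst e = t \<and> snd e \<in> set sl \<or> snd e = t \<and> fst e \<in> set sl) es \<noteq> []"
proof -
  obtain e where "e \<in> set es" "ends e = {s, t}" using assms by (metis imageE)
  then show ?thesis using assms(2) by (auto simp: filter_empty_conv ends_conv doubleton_eq_iff)
qed

lemma attach_ends:
  assumes "ends ` set es = edges G" "s \<in> set sl" "{s, t} \<in> edges G"
  shows "\<exists>s' \<in> set sl. ends (attach es sl t) = {s', t} \<and> {s', t} \<in> edges G"
proof -
  have "attach es sl t \<in> set (filter (\<lambda>e. fst e = t \<and> snd e \<in> set sl \<or> snd e = t \<and> fst e \<in> set sl) es)"
    unfolding attach_def by (rule hd_in_set[OF attach_candidates[OF assms]])
  then have "attach es sl t \<in> set es" and
    "(\<exists>s' \<in> set sl. ends (attach es sl t) = {s', t})" by (auto simp: ends_conv)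
  then show ?thesis using assms(1) by blast
qed

lemma of_cds_val_enc:
  assumes es: "ends ` set es = edges G" "\<forall>e \<in> edges G. e \<subseteq> set vs" and fl: "ends ` set fl \<subseteq> edges G"
    and dom: "dominates G (set sl) (set ts)"
  defines "W \<equiv> sl @ concat (map (\<lambda>e. [fst e, snd e]) fl)"
  shows "of_cds_val (VPair
      (enc_list [enc_weights w vs, enc_list (map enc_edge es), enc_list (map enc_vertex ts)])
      (enc_list [enc_list (map enc_edge fl), enc_list (map enc_vertex sl)])) =
    enc_list [enc_list (map enc_vertex (W @ ts)),
      enc_list (map enc_edge (fl @ map (attach es sl) (filter (\<lambda>t. t \<notin> set W) ts))),
      enc_list (map enc_vertex (sl @ map (cheaper w) fl))]"
    (is "of_cds_val (VPair ?x ?y) = _")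
proof -
  have W: "tree_verts_val ?y = enc_list (map enc_vertex W)"
    by (simp add: tree_verts_val_def W_def map_concat comp_def enc_edge_conv)
  have "attach_val (VPair ?x ?y) (enc_vertex t) = enc_edge (attach es sl t)"
    if t: "t \<in> set ts" "t \<notin> set W" for t
  proof -
    \<comment> \<open>Domination enters here: a terminal outside \<open>S\<close> has a neighbour in
      \<open>S\<close>, so there is a candidate edge and \<open>hd\<close> commutes with the
      encoding.\<close>
    have "t \<notin> set sl" using t by (simp add: W_def)
    then obtain s where "s \<in> set sl" "{s, t} \<in> edges G" using dom t by (auto simp: dominates_def)
    from attach_candidates[OF es(1) this] show ?thesis
      by (simp add: attach_val_def attach_def filter_map comp_def hd_map enc_edge_conv)
  qed
  then have att: "map (\<lambda>t. attach_val (VPair ?x ?y) (enc_vertex t)) (filter (\<lambda>t. t \<notin> set W) ts) =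
      map (\<lambda>t. enc_edge (attach es sl t)) (filter (\<lambda>t. t \<notin> set W) ts)" by simp
  have cheap: "map (\<lambda>e. cheaper_val (enc_weights w vs) (enc_edge e)) fl =
      map (\<lambda>e. enc_vertex (cheaper w e)) fl"
    by (rule map_cong[OF refl], rule cheaper_val_enc) (use es(2) fl in blast)
  have "of_cds_val (VPair ?x ?y) = enc_list [enc_list (map enc_vertex (W @ ts)),
      enc_list (map enc_edge fl @
        map (\<lambda>t. attach_val (VPair ?x ?y) (enc_vertex t)) (filter (\<lambda>t. t \<notin> set W) ts)),
      enc_list (map enc_vertex sl @ map (\<lambda>e. cheaper_val (enc_weights w vs) (enc_edge e)) fl)]"
    by (simp add: of_cds_val_def W[simplified] filter_map comp_def)
  then show ?thesis unfolding att cheap by (simp add: comp_def)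
qed

lemma single_vertex_feasible:
  assumes "v \<in> verts G" "T \<subseteq> {v}" "ugraph G"
  shows "vcst_feasible (G, w, T) (\<lparr>verts = {v}, edges = {}\<rparr>, {})"
proof -
  have "connected_graph \<lparr>verts = {v}, edges = {}\<rparr>"
    unfolding connected_graph_def by (auto simp: walk_def intro!: exI[of _ "[v]"])
  moreover have "\<not> cycle \<lparr>verts = {v}, edges = {}\<rparr> p" for p
    by (auto simp: cycle_def)
  ultimately show ?thesis using assms
    by (auto simp: tree_def ugraph_def subgraph_def vertex_cover_def)
qed

lemma single_vertex_val_enc:
  assumes "length ts \<le> 1" "set ts \<subseteq> set vs" "vs \<noteq> []"
  obtains v where "v \<in> set vs" "set ts \<subseteq> {v}"
    "single_vertex_val (enc_list [enc_weights w vs, es, enc_list (map enc_vertex ts)]) =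
      enc_list [enc_list (map enc_vertex [v]), enc_list (map enc_edge []), enc_list (map enc_vertex [])]"
proof (cases ts)
  case Nil
  then show ?thesis using assms(3)
    by (intro that[of "hd vs"]) (auto simp: single_vertex_val_def hd_map)
next
  case (Cons t ts')
  then have "ts = [t]" using assms(1) by (cases ts') auto
  then show ?thesis using assms(2) by (intro that[of t]) (auto simp: single_vertex_val_def)
qed

lemma encodes_vcst_solutionI:
  assumes "set us = verts F" "ends ` set es = edges F" "set cs = U"
  shows "encodes_solution vcst (enc_list [enc_list (map enc_vertex us), enc_list (map enc_edge es),
    enc_list (map enc_vertex cs)]) (F, U)"
  using assms unfolding vcst_def problem.simps vcst_encodes_solution.simps encodes_verts_def
    encodes_edges_def by blast

lemma vcst_objective_nonneg:
  assumes "vcst_feasible (G, w, T) (F, U)" "\<forall>v \<in> verts G. 0 \<le> w v"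
  shows "0 \<le> vcst_objective (G, w, T) (F, U)"
  using assms by (auto simp: subgraph_def vertex_cover_def intro!: sum_nonneg)

text \<open>The sign of \<open>b\<close> is unknown if \<open>a = 0\<close>, but then \<open>y = z = 0\<close>.\<close>

lemma ratio_compose:
  fixes x y z a b :: real
  assumes "0 \<le> y" "y \<le> x" "x \<le> b * a" "a \<le> c * z" "0 \<le> a" "0 \<le> z" "z \<le> y"
  shows "y \<le> c * b * z"
proof (cases "a = 0")
  case True
  then have "y = 0" "z = 0" using assms by auto
  then show ?thesis by simp
next
  case False
  have "0 \<le> b * a" using assms by linarith
  then have "0 \<le> b" using False assms(5) by (simp add: zero_le_mult_iff)
  then have "b * a \<le> b * (c * z)" using assms(4) by (rule mult_left_mono[rotated])
  then show ?thesis using assms by (simp add: algebra_simps)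
qed

text \<open>The minimum is one of the weights, so under \<open>Bit_Cost\<close> the derived lengths
  are again rational.\<close>

lemma min_weight_in_numbers:
  assumes "e \<noteq> {}" "finite e" "\<forall>v \<in> e. 0 \<le> w v \<and> w v \<in> numbers M"
  shows "0 \<le> Min (w ` e) \<and> Min (w ` e) \<in> numbers M \<and> (\<forall>v \<in> e. Min (w ` e) \<le> w v)"
proof -
  have "Min (w ` e) \<in> w ` e" using assms by (intro Min_in) auto
  then obtain v where "v \<in> e" "Min (w ` e) = w v" by blast
  then show ?thesis using assms by (metis Min_le finite_imageI imageI)
qed

section \<open>Instances with at most one terminal and with several terminals\<close>

lemma optimal_vcst_le:
  "optimal vcst i s \<Longrightarrow> vcst_feasible i s' \<Longrightarrow> vcst_objective i s \<le> vcst_objective i s'"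
  by (cases s') (auto simp: optimal_def vcst_def)

text \<open>The empty cover has weight 0, hence so has every optimal solution, and the bound holds
  whatever the sign of \<open>\<rho>\<close>.\<close>

lemma easy_instance:
  assumes G: "ugraph G" and inst: "(G, w, T) \<in> vcst_instances M \<G>"
    and enc: "vcst_encodes_instance x (G, w, T)" and feas: "vcst_feasible (G, w, T) s0"
    and easy: "\<not> is_pair (the_snd (the_fst (the_snd (the_snd x))))"
  shows "\<exists>s. encodes_solution vcst (single_vertex_val x) s \<and> feasible vcst (G, w, T) s \<and>
    (\<forall>s'. optimal vcst (G, w, T) s' \<longrightarrow>
      objective vcst (G, w, T) s \<le> \<rho> * objective vcst (G, w, T) s')"
proof -
  obtain vs es ts where x: "set vs = verts G" "set ts = T" 
      "x = enc_list [enc_weights w vs, enc_list (map enc_edge es), enc_list (map enc_vertex ts)]"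
    using enc by auto
  have w: "T \<subseteq> verts G" "\<forall>v \<in> verts G. 0 \<le> w v" using inst by (auto simp: vcst_instances_def)
  have "length ts \<le> 1"
    using easy x(3) by (cases ts; cases "tl ts") auto
  \<comment> \<open>The existence of a feasible tree guarantees a vertex to choose.\<close>
  moreover have "vs \<noteq> []"
    using feas x(1) by (cases s0) (auto simp: tree_def connected_graph_def subgraph_def)
  ultimately obtain v where v: "v \<in> set vs" "set ts \<subseteq> {v}"
    "single_vertex_val x = enc_list [enc_list (map enc_vertex [v]), enc_list (map enc_edge []),
        enc_list (map enc_vertex [])]"
    using single_vertex_val_enc[of ts vs w "enc_list (map enc_edge es)"] x w(1) by metis
  let ?s = "(\<lparr>verts = {v}, edges = {}\<rparr>, {}) :: vcst_solution"
  have s: "vcst_feasible (G, w, T) ?s"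
    by (rule single_vertex_feasible) (use v x G in auto)
  have "encodes_solution vcst (single_vertex_val x) ?s"
    unfolding v(3) by (rule encodes_vcst_solutionI) auto
  moreover have "objective vcst (G, w, T) ?s \<le> \<rho> * objective vcst (G, w, T) s'"
    if opt: "optimal vcst (G, w, T) s'" for s'
  proof -
    have "vcst_objective (G, w, T) s' \<le> 0" using optimal_vcst_le[OF opt s] by simp
    moreover have "vcst_feasible (G, w, T) s'" using opt by (simp add: optimal_def vcst_def)
    then have "0 \<le> vcst_objective (G, w, T) s'"
      using vcst_objective_nonneg[OF _ w(2)] by (metis surj_pair)
    ultimately show ?thesis by (simp add: vcst_def)
  qed
  ultimately show ?thesis using s by (intro exI[of _ ?s]) (simp add: vcst_def)
qed


lemma cds_instanceI:
  assumes G: "ugraph G" and inst: "(G, w, T) \<in> vcst_instances M \<G>"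
  shows "(G, w, \<lambda>e. Min (w ` e), T) \<in> cds_instances M \<G>"
proof -
  have "0 \<le> Min (w ` e) \<and> Min (w ` e) \<in> numbers M \<and> (\<forall>v \<in> e. Min (w ` e) \<le> w v)"
    if "e \<in> edges G" for e
  proof -
    have "e \<subseteq> verts G" "card e = 2" using G that by (auto simp: ugraph_def)
    then show ?thesis using inst
      by (intro min_weight_in_numbers) (auto simp: vcst_instances_def intro: card_ge_0_finite)
  qed
  then show ?thesis using inst by (simp add: cds_instances_def vcst_instances_def)
qed

text \<open>Terminals are listed without repetition, so two entries of the list are two different
  terminals.\<close>

lemma hard_instance:
  assumes G: "ugraph G" and inst: "(G, w, T) \<in> vcst_instances M \<G>"
    and enc: "vcst_encodes_instance x (G, w, T)"
    and hard: "is_pair (the_snd (the_fst (the_snd (the_snd x))))"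
  obtains t t' where "t \<in> T" "t' \<in> T" "t \<noteq> t'"
    "cds_encodes_instance (to_cds_val x) (G, w, \<lambda>e. Min (w ` e), T)"
proof -
  obtain vs es ts where x: "set vs = verts G" "distinct vs" "ends ` set es = edges G"
      "distinct (map ends es)" "set ts = T" "distinct ts"
      "x = enc_list [enc_weights w vs, enc_list (map enc_edge es), enc_list (map enc_vertex ts)]"
    using enc by auto
  obtain t t' ts' where ts: "ts = t # t' # ts'"
    using hard x(7) by (cases ts; cases "tl ts") auto
  have "ends e \<subseteq> set vs" if "e \<in> set es" for e
  proof -
    have "ends e \<in> edges G" using x(3) that by blast
    then show ?thesis using G x(1) by (simp add: ugraph_def)
  qed
  then have "\<forall>e \<in> set es. ends e \<subseteq> set vs" by blast
  from to_cds_val_enc[OF this] x have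
    "cds_encodes_instance (to_cds_val x) (G, w, \<lambda>e. Min (w ` e), T)"
    unfolding cds_encodes_instance.simps by (intro exI[of _ vs] exI[of _ es] exI[of _ ts]) simp
  then show ?thesis using that[of t t'] x(5,6) ts by auto
qed

text \<open>Matches the output of the program, described through lists, with the set-level
  construction of \<open>vcst_of_cds\<close>; the choices \<open>f\<close> and \<open>c\<close>
  there have to be those that the program makes.\<close>

lemma of_cds_val_correct:
  assumes G: "ugraph G" and inst: "(G, w, T) \<in> vcst_instances M \<G>"
    and enc: "vcst_encodes_instance x (G, w, T)" and "T \<noteq> {}"
    and sol: "cds_encodes_solution y (F, S)"
    and feas: "cds_feasible (G, w, \<lambda>e. Min (w ` e), T) (F, S)"
  obtains s where "encodes_solution vcst (of_cds_val (VPair x y)) s" "vcst_feasible (G, w, T) s"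
    "vcst_objective (G, w, T) s \<le> cds_objective (G, w, \<lambda>e. Min (w ` e), T) (F, S)"
proof -
  obtain vs es ts where x: "set vs = verts G" "ends ` set es = edges G" "set ts = T"
      "x = enc_list [enc_weights w vs, enc_list (map enc_edge es), enc_list (map enc_vertex ts)]"
    using enc by auto
  obtain fl sl where y: "ends ` set fl = F" "set sl = S"
      "y = enc_list [enc_list (map enc_edge fl), enc_list (map enc_vertex sl)]"
    using sol by (auto simp: encodes_verts_def encodes_edges_def)
  have w: "T \<subseteq> verts G" "\<forall>v \<in> verts G. 0 \<le> w v" using inst by (auto simp: vcst_instances_def)
  have eG: "\<forall>e \<in> edges G. e \<subseteq> verts G" using G by (simp add: ugraph_def)
  have F: "F \<subseteq> edges G" "dominates G S T" using feas by auto
  then have "S \<noteq> {}" using \<open>T \<noteq> {}\<close> by (auto simp: dominates_def)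
  define W where "W = sl @ concat (map (\<lambda>e. [fst e, snd e]) fl)"
  have W: "set W = S \<union> \<Union>F" using y(1,2) by (auto simp: W_def ends_conv)
  have "\<forall>t \<in> T - (S \<union> \<Union>F).
      \<exists>s. ends (attach es sl t) = {s, t} \<and> s \<in> S \<and> {s, t} \<in> edges G"
  proof
    fix t assume that: "t \<in> T - (S \<union> \<Union>F)"
    then have "t \<in> T" "t \<notin> S" by simp_all
    then have "\<exists>s \<in> set sl. {s, t} \<in> edges G"
      using F(2)[unfolded dominates_def, THEN bspec, of t] y(2) by simp
    then obtain s where "s \<in> set sl" "{s, t} \<in> edges G" by (rule bexE)
    from attach_ends[OF x(2) this]
    show "\<exists>s. ends (attach es sl t) = {s, t} \<and> s \<in> S \<and> {s, t} \<in> edges G" using y(2) by blast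
  qed
  \<comment> \<open>\<open>f t\<close> is the end in \<open>S\<close> of the very edge that the
    program selects for \<open>t\<close>.\<close>
  from bchoice[OF this] obtain f where f: "\<forall>t \<in> T - (S \<union> \<Union>F).
      ends (attach es sl t) = {f t, t} \<and> f t \<in> S \<and> {f t, t} \<in> edges G" by (rule exE)
  \<comment> \<open>\<open>cheaper\<close> works on ordered pairs, but \<open>c\<close> has to be a
    function on edges as sets. Any representative will do, because \<open>cheaper\<close> does not
    depend on the order of the ends.\<close>
  define c where "c e = cheaper w (SOME p. ends p = e)" for e
  have c: "c (ends p) = cheaper w p" for p
    unfolding c_def by (rule cheaper_ends) (rule someI[of "\<lambda>q. ends q = ends p" p, OF refl])
  have "\<forall>e \<in> F. c e \<in> e \<and> w (c e) = Min (w ` e)"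
    using c cheaper_in_ends weight_cheaper unfolding y(1)[symmetric] by simp
  note sol = vcst_of_cds[OF G w(2,1) feas \<open>S \<noteq> {}\<close> this, of f]
  let ?s = "(\<lparr>verts = S \<union> \<Union>F \<union> T, edges = F \<union> (\<lambda>t. {f t, t}) ` (T - (S \<union> \<Union>F))\<rparr>, S \<union> c ` F)"
  have "encodes_solution vcst (of_cds_val (VPair x y)) ?s"
    unfolding x(4) y(3)
  proof (subst of_cds_val_enc[OF x(2)])
    show "\<forall>e \<in> edges G. e \<subseteq> set vs" "ends ` set fl \<subseteq> edges G" "dominates G (set sl) (set ts)"
      using eG x y F by auto
    have "set (filter (\<lambda>t. t \<notin> set W) ts) = T - (S \<union> \<Union>F)" using W x(3) by auto
    then have "ends ` set (fl @ map (attach es sl) (filter (\<lambda>t. t \<notin> set W) ts)) =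
        F \<union> (\<lambda>t. {f t, t}) ` (T - (S \<union> \<Union>F))"
      using f y(1) by (auto simp: image_Un image_image)
    moreover have "cheaper w = c \<circ> ends" using c by (simp add: fun_eq_iff)
    then have "set (sl @ map (cheaper w) fl) = S \<union> c ` F"
      by (simp only: set_append set_map image_comp y(1)[symmetric] y(2))
    ultimately show "encodes_solution vcst
       (enc_list [enc_list (map enc_vertex ((sl @ concat (map (\<lambda>e. [fst e, snd e]) fl)) @ ts)),
        enc_list (map enc_edge (fl @ map (attach es sl)
          (filter (\<lambda>t. t \<notin> set (sl @ concat (map (\<lambda>e. [fst e, snd e]) fl))) ts))),
        enc_list (map enc_vertex (sl @ map (cheaper w) fl))]) ?s"
      unfolding W_def[symmetric] by (intro encodes_vcst_solutionI) (use W x(3) in auto)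
  qed
  then show ?thesis using sol f by (intro that[of ?s]) auto
qed

lemma cds_objective_nonneg:
  assumes "cds_feasible (G, w, l, T) (F, S)" "(G, w, l, T) \<in> cds_instances M \<G>"
  shows "0 \<le> cds_objective (G, w, l, T) (F, S)"
  using assms by (auto simp: cds_instances_def intro!: add_nonneg_nonneg sum_nonneg)

text \<open>\<open>r\<close> stands for the value of the dominating set solution that was found. The
  estimate passes from \<open>s\<close> to \<open>r\<close>, on to the optimum \<open>z\<close> of
  the derived instance, and from there through \<open>(F, U)\<close> to \<open>s'\<close>.\<close>

lemma optimal_ratio:
  assumes G: "ugraph G" and w: "\<forall>v \<in> verts G. 0 \<le> w v"
    and opt: "optimal vcst (G, w, T) (F, U)" "\<forall>u \<in> U. real (degree_in F u) \<le> a"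
    and tt': "t \<in> T" "t' \<in> T" "t \<noteq> t'"
    and inst: "(G, w, l, T) \<in> cds_instances M \<G>"
    and approx: "\<And>s'. optimal cds (G, w, l, T) s' \<Longrightarrow> r \<le> b * cds_objective (G, w, l, T) s'"
    and s: "vcst_feasible (G, w, T) s" "vcst_objective (G, w, T) s \<le> r"
    and opt': "optimal vcst (G, w, T) s'"
  shows "vcst_objective (G, w, T) s \<le> (a + 1) * b * vcst_objective (G, w, T) s'"
proof -
  have FU: "vcst_feasible (G, w, T) (F, U)" and s': "vcst_feasible (G, w, T) s'"
    using opt(1) opt' by (simp_all add: optimal_def vcst_def)
  have l: "\<forall>e \<in> edges G. \<forall>v \<in> e. l e \<le> w v" using inst by (auto simp: cds_instances_def)
  have cds: "cds_feasible (G, w, l, T) (edges F, U)" by (rule cds_of_vcst[OF FU tt'])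
  obtain z where z: "optimal cds (G, w, l, T) z" using cds_optimal_exists[OF G cds] by blast
  have zf: "cds_feasible (G, w, l, T) z" using z by (simp add: optimal_def cds_def)
  have "cds_objective (G, w, l, T) z \<le> cds_objective (G, w, l, T) (edges F, U)"
    using z cds by (simp add: optimal_def cds_def)
  also have "\<dots> \<le> (a + 1) * vcst_objective (G, w, T) (F, U)"
    by (rule cds_objective_le[OF G w FU l opt(2)])
  \<comment> \<open>The degree bound is known for one particular optimal solution only, but all
    optimal solutions have the same value.\<close>
  also have "vcst_objective (G, w, T) (F, U) = vcst_objective (G, w, T) s'"
    using optimal_vcst_le[OF opt(1) s'] optimal_vcst_le[OF opt' FU] by simp
  finally have "cds_objective (G, w, l, T) z \<le> (a + 1) * vcst_objective (G, w, T) s'" .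
  moreover have "0 \<le> vcst_objective (G, w, T) s" "0 \<le> vcst_objective (G, w, T) s'"
    using vcst_objective_nonneg[OF _ w] s(1) s' by (metis surj_pair)+
  moreover have "0 \<le> cds_objective (G, w, l, T) z"
    using cds_objective_nonneg[OF _ inst] zf by (metis surj_pair)
  ultimately show ?thesis
    using ratio_compose[OF _ s(2) approx[OF z]] optimal_vcst_le[OF opt' s(1)] by blast
qed

text \<open>A class of graphs takes the place of the single graph, so that polynomial time speaks
  about growing inputs, with one program for the whole class; a singleton class gives the literal
  reading.\<close>

theorem theorem4:
  fixes M :: cost_model and \<G> :: "graph set" and \<alpha> \<beta> :: "graph \<Rightarrow> real"
  assumes "\<And>G. G \<in> \<G> \<Longrightarrow> ugraph G"
    and "\<And>G w T. G \<in> \<G> \<Longrightarrow> \<forall>v \<in> verts G. 0 \<le> w v \<Longrightarrow> T \<subseteq> verts G \<Longrightarrow>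
           \<exists>s. feasible vcst (G, w, T) s \<Longrightarrow>
           \<exists>F U. optimal vcst (G, w, T) (F, U) \<and> (\<forall>u \<in> U. real (degree_in F u) \<le> \<alpha> G)"
    and "\<exists>A. approx_algorithm M cds (cds_instances M \<G>) (\<lambda>(G, w, l, T). \<beta> G) A"
  shows "\<exists>B. approx_algorithm M vcst (vcst_instances M \<G>) (\<lambda>(G, w, T). (\<alpha> G + 1) * \<beta> G) B"
proof -
  let ?hard = "\<lambda>x. is_pair (the_snd (the_fst (the_snd (the_snd x))))"
  obtain A pA where A: "\<And>G w l T x. (G, w, l, T) \<in> cds_instances M \<G> \<Longrightarrow>
      \<exists>s. cds_feasible (G, w, l, T) s \<Longrightarrow> cds_encodes_instance x (G, w, l, T) \<Longrightarrow>
      \<exists>t y F S. computes M A x t y \<and> t \<le> poly pA (val_size M x) \<and>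
        cds_encodes_solution y (F, S) \<and> cds_feasible (G, w, l, T) (F, S) \<and>
        (\<forall>s'. optimal cds (G, w, l, T) s' \<longrightarrow>
          cds_objective (G, w, l, T) (F, S) \<le> \<beta> G * cds_objective (G, w, l, T) s')"
  proof -
    obtain A where "approx_algorithm M cds (cds_instances M \<G>) (\<lambda>(G, w, l, T). \<beta> G) A"
      using assms(3) by blast
    then obtain p where p: "\<And>i x. i \<in> cds_instances M \<G> \<Longrightarrow> \<exists>s. feasible cds i s \<Longrightarrow>
        encodes_instance cds x i \<Longrightarrow>
        \<exists>t y s. computes M A x t y \<and> t \<le> poly p (val_size M x) \<and>
          encodes_solution cds y s \<and> feasible cds i s \<and>
          (\<forall>s'. optimal cds i s' \<longrightarrow>
            objective cds i s \<le> (case i of (G, w, l, T) \<Rightarrow> \<beta> G) * objective cds i s')"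
      unfolding approx_algorithm_def by blast
    have cds: "feasible cds = cds_feasible" "objective cds = cds_objective"
      "encodes_instance cds = cds_encodes_instance" "encodes_solution cds = cds_encodes_solution"
      by (simp_all add: cds_def)
    show ?thesis
    proof (rule that)
      fix G w l T x
      assume "(G, w, l, T) \<in> cds_instances M \<G>" "\<exists>s. cds_feasible (G, w, l, T) s"
        "cds_encodes_instance x (G, w, l, T)"
      from p[of "(G, w, l, T)", unfolded cds prod.case, OF this]
      show "\<exists>t y F S. computes M A x t y \<and> t \<le> poly p (val_size M x) \<and>
        cds_encodes_solution y (F, S) \<and> cds_feasible (G, w, l, T) (F, S) \<and>
        (\<forall>s'. optimal cds (G, w, l, T) s' \<longrightarrow>
          cds_objective (G, w, l, T) (F, S) \<le> \<beta> G * cds_objective (G, w, l, T) s')"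
        by (metis surj_pair)
    qed
  qed
  obtain B p where easy: "\<And>x. \<not> ?hard x \<Longrightarrow>
      \<exists>t. computes M B x t (single_vertex_val x) \<and> t \<le> poly p (val_size M x)"
    and hard: "\<And>x t y. ?hard x \<Longrightarrow> computes M A (to_cds_val x) t y \<Longrightarrow>
      t \<le> poly pA (val_size M (to_cds_val x)) \<Longrightarrow>
      \<exists>t'. computes M B x t' (of_cds_val (VPair x y)) \<and> t' \<le> poly p (val_size M x)"
    using polytime_reduction[OF polytime_to_cds_val polytime_of_cds_val polytime_single_vertex_val
        polytest_two_terminals, where A = A and pA = pA] by blast
  have correct: "\<exists>t y s. computes M B x t y \<and> t \<le> poly p (val_size M x) \<and>
      encodes_solution vcst y s \<and> feasible vcst (G, w, T) s \<and>
      (\<forall>s'. optimal vcst (G, w, T) s' \<longrightarrow>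
        objective vcst (G, w, T) s \<le> (\<alpha> G + 1) * \<beta> G * objective vcst (G, w, T) s')"
    if inst: "(G, w, T) \<in> vcst_instances M \<G>" and feas: "\<exists>s. feasible vcst (G, w, T) s"
      and x: "encodes_instance vcst x (G, w, T)" for G w T x
  proof -
    have "G \<in> \<G>" and wT: "\<forall>v \<in> verts G. 0 \<le> w v" "T \<subseteq> verts G"
      using inst by (auto simp: vcst_instances_def)
    then have G: "ugraph G" using assms(1) by blast
    have enc: "vcst_encodes_instance x (G, w, T)" using x by (simp add: vcst_def)
    show ?thesis
    proof (cases "?hard x")
      case False
      obtain s0 where "vcst_feasible (G, w, T) s0" using feas by (auto simp: vcst_def)
      from easy_instance[OF G inst enc this False] easy[OF False] show ?thesis by blast
    next
      case True
      let ?l = "\<lambda>e. Min (w ` e)"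
      obtain t t' where tt': "t \<in> T" "t' \<in> T" "t \<noteq> t'"
        and enc': "cds_encodes_instance (to_cds_val x) (G, w, ?l, T)"
        using hard_instance[OF G inst enc True] by blast
      have inst': "(G, w, ?l, T) \<in> cds_instances M \<G>" by (rule cds_instanceI[OF G inst])
      obtain F U where FU: "optimal vcst (G, w, T) (F, U)" "\<forall>u \<in> U. real (degree_in F u) \<le> \<alpha> G"
        using assms(2)[OF \<open>G \<in> \<G>\<close> wT feas] by blast
      then have "vcst_feasible (G, w, T) (F, U)" by (simp add: optimal_def vcst_def)
      \<comment> \<open>\<open>A\<close> promises an answer only for instances with a feasible
        solution; the optimal Steiner tree supplies one.\<close>
      from A[OF inst' _ enc'] cds_of_vcst[OF this tt'] obtain ta y Fa S where
        y: "computes M A (to_cds_val x) ta y" "ta \<le> poly pA (val_size M (to_cds_val x))"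
          "cds_encodes_solution y (Fa, S)" "cds_feasible (G, w, ?l, T) (Fa, S)"
        and approx: "\<And>s'. optimal cds (G, w, ?l, T) s' \<Longrightarrow>
          cds_objective (G, w, ?l, T) (Fa, S) \<le> \<beta> G * cds_objective (G, w, ?l, T) s'"
        by blast
      have "T \<noteq> {}" using tt' by auto
      from of_cds_val_correct[OF G inst enc this y(3,4)] obtain s where
        s: "encodes_solution vcst (of_cds_val (VPair x y)) s" "vcst_feasible (G, w, T) s"
          "vcst_objective (G, w, T) s \<le> cds_objective (G, w, ?l, T) (Fa, S)" by blast
      have "vcst_objective (G, w, T) s \<le> (\<alpha> G + 1) * \<beta> G * vcst_objective (G, w, T) s'"
        if "optimal vcst (G, w, T) s'" for s'
        by (rule optimal_ratio[OF G wT(1) FU tt' inst' approx s(2,3) that])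
      then have "feasible vcst (G, w, T) s \<and> (\<forall>s'. optimal vcst (G, w, T) s' \<longrightarrow>
        objective vcst (G, w, T) s \<le> (\<alpha> G + 1) * \<beta> G * objective vcst (G, w, T) s')"
        using s(2) by (simp add: vcst_def)
      with hard[OF True y(1,2)] s(1) show ?thesis by blast
    qed
  qed
  have "approx_algorithm M vcst (vcst_instances M \<G>) (\<lambda>(G, w, T). (\<alpha> G + 1) * \<beta> G) B"
    unfolding approx_algorithm_def
  proof (rule exI[of _ p], intro ballI allI impI)
    fix i x
    assume i: "i \<in> vcst_instances M \<G>"
      and x: "(\<exists>s. feasible vcst i s) \<and> encodes_instance vcst x i"
    obtain G w T where eq: "i = (G, w, T)" by (cases i)
    show "\<exists>t y s. computes M B x t y \<and> t \<le> poly p (val_size M x) \<and>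
        encodes_solution vcst y s \<and> feasible vcst i s \<and>
        (\<forall>s'. optimal vcst i s' \<longrightarrow> objective vcst i s \<le>
          (case i of (G, w, T) \<Rightarrow> (\<alpha> G + 1) * \<beta> G) * objective vcst i s')"
      using i x unfolding eq prod.case by (intro correct) simp_all
  qed
  then show ?thesis by blast
qed

end
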